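(* Let $F$ be a non-dyadic non-archimedean local field and $n\ge 2$ an integer. Let $M$ be an integral $\mathcal{O}_F$-lattice of rank $n+1$ or $n+2$. Then $M$ is $n$-ADC if and only if $M$ is $\mathcal{O}_F$-maximal.
   Context: An integral $\mathcal{O}_F$-lattice is a finitely generated $\mathcal{O}_F$-submodule of a non-degenerate quadratic space over $F$ with norm ideal $\mathfrak{n}(M)\subseteq\mathcal{O}_F$. $M$ is $n$-ADC if for every integral $\mathcal{O}_F$-lattice $N$ of rank $n$ such that $FM$ represents $FN$, $M$ represents $N$. $M$ is $\mathcal{O}_F$-maximal if $\mathfrak{n}(M)\subseteq\mathcal{O}_F$ and $M$ contains every lattice on $FM$ whose norm is contained in $\mathcal{O}_F$. Non-dyadic means $2\in\mathcal{O}_F^\times$.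
   Formalization: O_F-maximal is taken in the standard sense: no strictly larger lattice on FM containing M has norm in O_F (the literal "contains every such lattice" fails for isotropic FM, e.g. H ⊥ <1> over Q_3); for integral lattices, M and the tested N, the spanned space itself is required non-degenerate. *)

theory Defs
  imports Complex_Main "HOL-Library.Function_Algebras"
begin

section \<open>Non-archimedean local fields\<close>

text \<open>
  A valuation is a map \<open>v\<close> into the integers that is only meaningful at nonzero arguments
  (mathematically \<open>v 0 = \<infinity>\<close>); the value \<open>v 0\<close> is never used.
\<close>

definition val_ge :: "('f::field \<Rightarrow> int) \<Rightarrow> int \<Rightarrow> 'f \<Rightarrow> bool" where
  "val_ge v k x \<longleftrightarrow> x = 0 \<or> k \<le> v x"

definition ring_of_integers :: "('f::field \<Rightarrow> int) \<Rightarrow> 'f set" where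
  "ring_of_integers v = {x. val_ge v 0 x}"

definition maximal_ideal :: "('f::field \<Rightarrow> int) \<Rightarrow> 'f set" where
  "maximal_ideal v = {x. val_ge v 1 x}"

definition integer_units :: "('f::field \<Rightarrow> int) \<Rightarrow> 'f set" where
  "integer_units v = {x \<in> ring_of_integers v. \<exists>y \<in> ring_of_integers v. x * y = 1}"

definition residue_field :: "('f::field \<Rightarrow> int) \<Rightarrow> 'f set set" where
  "residue_field v =
     ring_of_integers v //
       {(x, y). x \<in> ring_of_integers v \<and> y \<in> ring_of_integers v \<and> x - y \<in> maximal_ideal v}"

text \<open>
  Complete with respect to a normalized discrete valuation, with finite residue field.
  No assumption is made on the characteristic.
\<close>

locale nonarch_local_field =
  fixes v :: "'f::field \<Rightarrow> int"
  assumes val_mult: "x \<noteq> 0 \<Longrightarrow> y \<noteq> 0 \<Longrightarrow> v (x * y) = v x + v y"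
    and val_add: "x \<noteq> 0 \<Longrightarrow> y \<noteq> 0 \<Longrightarrow> x + y \<noteq> 0 \<Longrightarrow> min (v x) (v y) \<le> v (x + y)"
    and uniformizer: "\<exists>x. x \<noteq> 0 \<and> v x = 1"
    and finite_residue_field: "finite (residue_field v)"
    and complete:
      "(\<And>k. \<exists>N. \<forall>i\<ge>N. \<forall>j\<ge>N. val_ge v k (X i - X j)) \<Longrightarrow>
         \<exists>L. \<forall>k. \<exists>N. \<forall>i\<ge>N. val_ge v k ((X :: nat \<Rightarrow> 'f) i - L)"

definition non_dyadic :: "('f::field \<Rightarrow> int) \<Rightarrow> bool" where
  "non_dyadic v \<longleftrightarrow> 2 \<in> integer_units v"


section \<open>Quadratic spaces\<close>

text \<open>
  A quadratic space over \<open>'f\<close> is a finite-dimensional subspace \<open>V\<close> of an ambient vector space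
  \<open>'v\<close> (with scalar multiplication \<open>scale\<close>) together with a form \<open>B\<close> that is symmetric and
  bilinear on \<open>V\<close>; the values of \<open>B\<close> outside \<open>V\<close> are irrelevant. The quadratic form is
  \<open>Q x = B x x\<close>.
\<close>

definition quadratic_space ::
  "('f::field \<Rightarrow> 'v::ab_group_add \<Rightarrow> 'v) \<Rightarrow> ('v \<Rightarrow> 'v \<Rightarrow> 'f) \<Rightarrow> 'v set \<Rightarrow> bool" where
  "quadratic_space scale B V \<longleftrightarrow>
     vector_space scale \<and>
     (\<exists>S. finite S \<and> V = module.span scale S) \<and>
     (\<forall>x\<in>V. \<forall>y\<in>V. B x y = B y x) \<and>
     (\<forall>x\<in>V. \<forall>y\<in>V. \<forall>z\<in>V. B (x + y) z = B x z + B y z) \<and>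
     (\<forall>c. \<forall>x\<in>V. \<forall>y\<in>V. B (scale c x) y = c * B x y)"

definition nondegenerate :: "('v::ab_group_add \<Rightarrow> 'v \<Rightarrow> 'f::field) \<Rightarrow> 'v set \<Rightarrow> bool" where
  "nondegenerate B V \<longleftrightarrow> (\<forall>x\<in>V. (\<forall>y\<in>V. B x y = 0) \<longrightarrow> x = 0)"

text \<open>
  Representations of quadratic spaces, respectively lattices. Every linear map on a subspace is the
  restriction of a linear map on the ambient space, so \<open>\<sigma>\<close> may be taken total.
\<close>

definition space_represents ::
  "('f::field \<Rightarrow> 'v::ab_group_add \<Rightarrow> 'v) \<Rightarrow> ('v \<Rightarrow> 'v \<Rightarrow> 'f) \<Rightarrow> 'v set \<Rightarrow>
   ('f \<Rightarrow> 'w::ab_group_add \<Rightarrow> 'w) \<Rightarrow> ('w \<Rightarrow> 'w \<Rightarrow> 'f) \<Rightarrow> 'w set \<Rightarrow> bool" where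
  "space_represents scaleV B V scaleW C W \<longleftrightarrow>
     (\<exists>\<sigma>. Vector_Spaces.linear scaleW scaleV \<sigma> \<and> \<sigma> ` W \<subseteq> V \<and>
          (\<forall>x\<in>W. B (\<sigma> x) (\<sigma> x) = C x x))"

definition lattice_represents ::
  "('f::field \<Rightarrow> 'v::ab_group_add \<Rightarrow> 'v) \<Rightarrow> ('v \<Rightarrow> 'v \<Rightarrow> 'f) \<Rightarrow> 'v set \<Rightarrow>
   ('f \<Rightarrow> 'w::ab_group_add \<Rightarrow> 'w) \<Rightarrow> ('w \<Rightarrow> 'w \<Rightarrow> 'f) \<Rightarrow> 'w set \<Rightarrow> bool" where
  "lattice_represents scaleV B M scaleW C N \<longleftrightarrow>
     (\<exists>\<sigma>. Vector_Spaces.linear scaleW scaleV \<sigma> \<and> \<sigma> ` module.span scaleW N \<subseteq> module.span scaleV M \<and>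
          (\<forall>x\<in>module.span scaleW N. B (\<sigma> x) (\<sigma> x) = C x x) \<and> \<sigma> ` N \<subseteq> M)"


section \<open>Lattices\<close>

definition integer_span ::
  "('f::field \<Rightarrow> int) \<Rightarrow> ('f \<Rightarrow> 'v::ab_group_add \<Rightarrow> 'v) \<Rightarrow> 'v set \<Rightarrow> 'v set" where
  "integer_span v scale S =
     {\<Sum>x\<in>T. scale (c x) x | T c. finite T \<and> T \<subseteq> S \<and> (\<forall>x\<in>T. c x \<in> ring_of_integers v)}"

definition lattice ::
  "('f::field \<Rightarrow> int) \<Rightarrow> ('f \<Rightarrow> 'v::ab_group_add \<Rightarrow> 'v) \<Rightarrow> 'v set \<Rightarrow> bool" where
  "lattice v scale M \<longleftrightarrow> (\<exists>S. finite S \<and> M = integer_span v scale S)"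

definition norm_ideal ::
  "('f::field \<Rightarrow> int) \<Rightarrow> ('v::ab_group_add \<Rightarrow> 'v \<Rightarrow> 'f) \<Rightarrow> 'v set \<Rightarrow> 'f set" where
  "norm_ideal v B M = integer_span v (*) {B x x | x. x \<in> M}"

text \<open>The space \<open>FM\<close> spanned by \<open>M\<close> is \<open>module.span scale M\<close>, and the rank of \<open>M\<close> is its dimension.\<close>

definition lattice_rank ::
  "('f::field \<Rightarrow> 'v::ab_group_add \<Rightarrow> 'v) \<Rightarrow> 'v set \<Rightarrow> nat" where
  "lattice_rank scale M = vector_space.dim scale (module.span scale M)"

definition integral_lattice ::
  "('f::field \<Rightarrow> int) \<Rightarrow> ('f \<Rightarrow> 'v::ab_group_add \<Rightarrow> 'v) \<Rightarrow> ('v \<Rightarrow> 'v \<Rightarrow> 'f) \<Rightarrow> 'v set \<Rightarrow> bool" where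
  "integral_lattice v scale B M \<longleftrightarrow>
     quadratic_space scale B (module.span scale M) \<and> nondegenerate B (module.span scale M) \<and>
     lattice v scale M \<and> norm_ideal v B M \<subseteq> ring_of_integers v"

text \<open>Maximality is with respect to inclusion among the lattices of integral norm on \<open>FM\<close>.\<close>

definition maximal_lattice ::
  "('f::field \<Rightarrow> int) \<Rightarrow> ('f \<Rightarrow> 'v::ab_group_add \<Rightarrow> 'v) \<Rightarrow> ('v \<Rightarrow> 'v \<Rightarrow> 'f) \<Rightarrow> 'v set \<Rightarrow> bool" where
  "maximal_lattice v scale B M \<longleftrightarrow>
     norm_ideal v B M \<subseteq> ring_of_integers v \<and>
     (\<forall>K. lattice v scale K \<and> module.span scale K = module.span scale M \<and>
          norm_ideal v B K \<subseteq> ring_of_integers v \<and> M \<subseteq> K \<longrightarrow> K = M)"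

text \<open>
  A definition cannot quantify over all types of ambient vector spaces. The lattices \<open>N\<close> tested in
  the definition of \<open>n\<close>-ADC therefore live in the space of all sequences over the field, into which
  every finite-dimensional space embeds. Lemma \<open>n_ADC_represents\<close> below shows that this loses nothing:
  the defining property then holds for lattices in arbitrary ambient vector spaces.
\<close>

definition seq_scale :: "'f::field \<Rightarrow> (nat \<Rightarrow> 'f) \<Rightarrow> (nat \<Rightarrow> 'f)" where
  "seq_scale c x = (\<lambda>i. c * x i)"

definition n_ADC ::
  "('f::field \<Rightarrow> int) \<Rightarrow> nat \<Rightarrow> ('f \<Rightarrow> 'v::ab_group_add \<Rightarrow> 'v) \<Rightarrow> ('v \<Rightarrow> 'v \<Rightarrow> 'f) \<Rightarrow> 'v set \<Rightarrow> bool"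
  where
  "n_ADC v n scale B M \<longleftrightarrow>
     (\<forall>C N. integral_lattice v seq_scale C N \<and> lattice_rank seq_scale N = n \<and>
            space_represents scale B (module.span scale M) seq_scale C (module.span seq_scale N) \<longrightarrow>
            lattice_represents scale B M seq_scale C N)"


section \<open>Independence of the ambient space\<close>

lemma vector_space_seq_scale: "vector_space (seq_scale :: 'f::field \<Rightarrow> _)"
  by unfold_locales (auto simp: seq_scale_def fun_eq_iff algebra_simps)

lemma sum_fun_apply: "(\<Sum>a\<in>A. g a) i = (\<Sum>a\<in>A. g a i)"
  for g :: "'a \<Rightarrow> 'b \<Rightarrow> 'c::comm_monoid_add"
  by (induction A rule: infinite_finite_induct) auto

lemma integer_span_inj_image:
  assumes "Vector_Spaces.linear s1 s2 f" and inj: "inj_on f S"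
  shows "integer_span v s2 (f ` S) = f ` integer_span v s1 S"
proof -
  interpret f: Vector_Spaces.linear s1 s2 f by fact
  have *: "f (\<Sum>x\<in>T. s1 (c x) x) = (\<Sum>x\<in>T. s2 (c x) (f x))" for c T
    by (simp add: f.sum f.scale)
  show ?thesis
  proof (intro equalityI subsetI)
    fix y assume "y \<in> integer_span v s2 (f ` S)"
    then obtain T c where T: "finite T" "T \<subseteq> f ` S" "\<forall>x\<in>T. c x \<in> ring_of_integers v"
      and y: "y = (\<Sum>x\<in>T. s2 (c x) x)" unfolding integer_span_def by blast
    obtain T' where T': "T' \<subseteq> S" "finite T'" "T = f ` T'"
      using T by (meson finite_subset_image)
    have "inj_on f T'" using inj T'(1) inj_on_subset by blast
    then have "y = f (\<Sum>x\<in>T'. s1 (c (f x)) x)"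
      unfolding * y T'(3) by (simp add: sum.reindex)
    then show "y \<in> f ` integer_span v s1 S"
      using T T' unfolding integer_span_def by (auto intro!: imageI exI[of _ T'] exI[of _ "\<lambda>x. c (f x)"])
  next
    fix y assume "y \<in> f ` integer_span v s1 S"
    then obtain T c where T: "finite T" "T \<subseteq> S" "\<forall>x\<in>T. c x \<in> ring_of_integers v"
      and y: "y = (\<Sum>x\<in>T. s2 (c x) (f x))" unfolding integer_span_def using * by auto
    have i: "inj_on f T" using inj T(2) inj_on_subset by blast
    have "y = (\<Sum>x\<in>f ` T. s2 (c (the_inv_into T f x)) x)"
      unfolding y by (simp add: sum.reindex[OF i] the_inv_into_f_f[OF i])
    then show "y \<in> integer_span v s2 (f ` S)"
      using T unfolding integer_span_def
      by (auto intro!: exI[of _ "f ` T"] exI[of _ "\<lambda>x. c (the_inv_into T f x)"]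
          simp: the_inv_into_f_f[OF i])
  qed
qed

lemma embed_seq:
  fixes scale :: "'f::field \<Rightarrow> 'w::ab_group_add \<Rightarrow> 'w"
  assumes "vector_space scale" and "finite S"
  obtains f g where "Vector_Spaces.linear scale seq_scale f" "Vector_Spaces.linear seq_scale scale g"
    "\<forall>x\<in>module.span scale S. g (f x) = x"
proof -
  interpret W: vector_space scale by fact
  interpret F: vector_space "seq_scale :: 'f \<Rightarrow> _" by (rule vector_space_seq_scale)
  interpret WF: vector_space_pair scale "seq_scale :: 'f \<Rightarrow> _" ..
  interpret FW: vector_space_pair "seq_scale :: 'f \<Rightarrow> _" scale ..
  obtain b where b: "b \<subseteq> S" "W.independent b" "S \<subseteq> W.span b"
    using W.maximal_independent_subset[of S] by blast
  have bs: "W.span b = W.span S"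
    by (rule equalityI) (use b W.span_mono W.span_minimal[OF b(3) W.subspace_span] in auto)
  have "finite b" using b(1) assms(2) finite_subset by blast
  then obtain h :: "'w \<Rightarrow> nat" where h: "inj_on h b"
    using finite_imp_inj_to_nat_seg by blast
  define e :: "'w \<Rightarrow> nat \<Rightarrow> 'f" where "e x = (\<lambda>i. if i = h x then 1 else 0)" for x
  obtain f where f: "Vector_Spaces.linear scale seq_scale f" "\<forall>x\<in>b. f x = e x"
    using WF.linear_independent_extend[OF b(2)] by blast
  interpret f: Vector_Spaces.linear scale "seq_scale :: 'f \<Rightarrow> _" f by fact
  have "inj_on f (W.span b)"
  proof (subst f.inj_on_iff_eq_0[OF W.subspace_span], intro ballI impI)
    fix x assume x: "x \<in> W.span b" and 0: "f x = 0"
    obtain u where u: "x = (\<Sum>a\<in>b. scale (u a) a)"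
      using x W.span_finite[OF \<open>finite b\<close>] by auto
    have u0: "u a = 0" if "a \<in> b" for a
    proof -
      have "f x (h a) = (\<Sum>a'\<in>b. seq_scale (u a') (e a') (h a))"
        using f(2) by (simp add: u f.sum f.scale sum_fun_apply)
      also have "\<dots> = (\<Sum>a'\<in>b. if a' = a then u a else 0)"
        using h that by (intro sum.cong) (auto simp: seq_scale_def e_def inj_on_def)
      also have "\<dots> = u a" using that \<open>finite b\<close> by simp
      finally show ?thesis using 0 by simp
    qed
    then show "x = 0" unfolding u by simp
  qed
  then obtain g where "Vector_Spaces.linear seq_scale scale g" "\<forall>x\<in>W.span b. g (f x) = x"
    using WF.linear_inj_on_left_inverse[OF f(1)] by blast
  then show thesis using that f(1) bs by simp
qed

lemma n_ADC_represents:
  fixes scaleW :: "'f::field \<Rightarrow> 'w::ab_group_add \<Rightarrow> 'w"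
  assumes adc: "n_ADC v n scale B M"
    and N: "integral_lattice v scaleW C N" and rank: "lattice_rank scaleW N = n"
    and rep: "space_represents scale B (module.span scale M) scaleW C (module.span scaleW N)"
  shows "lattice_represents scale B M scaleW C N"
proof -
  have qs: "quadratic_space scaleW C (module.span scaleW N)"
    and nd: "nondegenerate C (module.span scaleW N)"
    using N by (auto simp: integral_lattice_def)
  obtain S where S: "finite S" "N = integer_span v scaleW S"
    using N by (auto simp: integral_lattice_def lattice_def)
  obtain S' where S': "finite S'" "module.span scaleW N = module.span scaleW S'"
    using qs by (auto simp: quadratic_space_def)
  interpret W: vector_space scaleW using qs by (simp add: quadratic_space_def)
  interpret F: vector_space "seq_scale :: 'f \<Rightarrow> _" by (rule vector_space_seq_scale)
  interpret WF: vector_space_pair scaleW "seq_scale :: 'f \<Rightarrow> _" ..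
  let ?U = "W.span (S \<union> S')"
  obtain f g where lf: "Vector_Spaces.linear scaleW seq_scale f"
    and lg: "Vector_Spaces.linear seq_scale scaleW g" and gf: "\<forall>x\<in>?U. g (f x) = x"
    using embed_seq[OF W.vector_space_axioms, of "S \<union> S'"] S S' by auto
  interpret f: Vector_Spaces.linear scaleW "seq_scale :: 'f \<Rightarrow> _" f by fact
  interpret g: Vector_Spaces.linear "seq_scale :: 'f \<Rightarrow> _" scaleW g by fact
  have sub: "W.span N \<subseteq> ?U" using S' W.span_mono[of S' "S \<union> S'"] by simp
  then have gfN: "g (f x) = x" if "x \<in> W.span N" for x using gf that by blast
  then have injN: "inj_on f (W.span N)" by (metis inj_onI)
  have injS: "inj_on f S" using gf W.span_base by (metis UnI1 inj_onI)
  have N': "f ` N = integer_span v seq_scale (f ` S)"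
    using integer_span_inj_image[OF lf injS] S by simp
  have span': "F.span (f ` N) = f ` W.span N" by (rule f.span_image)
  define C' where "C' x y = C (g x) (g y)" for x y
  have C': "C' (f x) (f y) = C x y" if "x \<in> W.span N" "y \<in> W.span N" for x y
    using gfN that by (simp add: C'_def)
  have "quadratic_space seq_scale C' (F.span (f ` N))"
    unfolding quadratic_space_def
  proof (intro conjI)
    show "vector_space (seq_scale :: 'f \<Rightarrow> _)" by (rule vector_space_seq_scale)
    show "\<exists>S. finite S \<and> F.span (f ` N) = F.span S"
      using S' by (metis finite_imageI f.span_image)
    show "\<forall>x\<in>F.span (f ` N). \<forall>y\<in>F.span (f ` N). C' x y = C' y x"
      using qs by (auto simp: span' C' quadratic_space_def)
    show "\<forall>x\<in>F.span (f ` N). \<forall>y\<in>F.span (f ` N). \<forall>z\<in>F.span (f ` N). C' (x + y) z = C' x z + C' y z"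
      using qs by (auto simp: span' C' quadratic_space_def W.span_add simp flip: f.add)
    show "\<forall>c. \<forall>x\<in>F.span (f ` N). \<forall>y\<in>F.span (f ` N). C' (seq_scale c x) y = c * C' x y"
      using qs by (auto simp: span' C' quadratic_space_def W.span_scale simp flip: f.scale)
  qed
  moreover have "nondegenerate C' (F.span (f ` N))"
    using nd by (auto simp: nondegenerate_def span' C' f.zero)
  moreover have "lattice v seq_scale (f ` N)"
    unfolding lattice_def using N' S(1) by blast
  moreover have "{C' x x | x. x \<in> f ` N} = {C x x | x. x \<in> N}"
    using C' W.span_base[of _ N] by (auto simp: image_iff) metis
  then have "norm_ideal v C' (f ` N) \<subseteq> ring_of_integers v"
    using N by (simp add: norm_ideal_def integral_lattice_def)
  ultimately have il: "integral_lattice v seq_scale C' (f ` N)"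
    by (simp add: integral_lattice_def)
  have rk: "lattice_rank seq_scale (f ` N) = n"
  proof -
    obtain b where b: "b \<subseteq> N" "W.independent b" "N \<subseteq> W.span b"
    using W.maximal_independent_subset[of N] by blast
  have bs: "W.span b = W.span N"
    by (rule equalityI) (use b W.span_mono W.span_minimal[OF b(3) W.subspace_span] in auto)
    have inj: "inj_on f (W.span b)" using injN bs by simp
    have "F.independent (f ` b)"
      using f.independent_inj_on_image[OF b(2) inj] by simp
    moreover have "F.span (f ` b) = F.span (f ` N)"
      using bs by (simp add: f.span_image)
    moreover have "card (f ` b) = card b"
      using inj W.span_superset by (meson card_image inj_on_subset)
    ultimately have "F.dim (f ` N) = card b"
      by (metis F.dim_eq_card)
    moreover have "W.dim N = card b" using b(2) bs by (metis W.dim_eq_card)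
    ultimately show ?thesis using rank by (simp add: lattice_rank_def)
  qed
  obtain \<sigma> where \<sigma>: "Vector_Spaces.linear scaleW scale \<sigma>" "\<sigma> ` W.span N \<subseteq> module.span scale M"
    "\<forall>x\<in>W.span N. B (\<sigma> x) (\<sigma> x) = C x x"
    using rep by (auto simp: space_represents_def)
  have "space_represents scale B (module.span scale M) seq_scale C' (F.span (f ` N))"
    unfolding space_represents_def
  proof (intro exI conjI)
    show "Vector_Spaces.linear seq_scale scale (\<sigma> \<circ> g)"
      using Vector_Spaces.linear_compose[OF lg \<sigma>(1)] .
  qed (use \<sigma> gfN C' in \<open>auto simp: span'\<close>)
  with adc il rk have "lattice_represents scale B M seq_scale C' (f ` N)"
    unfolding n_ADC_def by blast
  then obtain \<tau> where \<tau>: "Vector_Spaces.linear seq_scale scale \<tau>"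
    "\<tau> ` F.span (f ` N) \<subseteq> module.span scale M"
    "\<forall>x\<in>F.span (f ` N). B (\<tau> x) (\<tau> x) = C' x x" "\<tau> ` f ` N \<subseteq> M"
    by (auto simp: lattice_represents_def)
  show ?thesis
    unfolding lattice_represents_def
  proof (intro exI conjI)
    show "Vector_Spaces.linear scaleW scale (\<tau> \<circ> f)"
      using Vector_Spaces.linear_compose[OF lf \<tau>(1)] .
  qed (use \<tau> C' in \<open>auto simp: span'\<close>)
qed

end

theory Submission
  imports Defs
begin

text \<open>
  \<^bold>\<open>Maximal implies ADC.\<close> Let \<open>M\<close> be maximal and \<open>N\<close> an integral module in \<open>FM\<close>. If \<open>B(N, M)\<close> is
  integral, then \<open>N \<subseteq> M\<close> by maximality. Otherwise take \<open>x \<in> N\<close>, \<open>y \<in> M\<close> with \<open>B(x, y)\<close> of least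
  valuation and let \<open>\<beta>\<close> be its inverse. The hyperbolic planes \<open>\<langle>x, \<beta> y\<rangle>\<close> and \<open>\<langle>y, \<beta> x\<rangle>\<close> span the same
  subspace and split off from \<open>N + \<O> \<beta> y\<close> and from \<open>M\<close>. They are isometric, and induction on the
  dimension moves \<open>N\<close> into \<open>M\<close>.

  \<^bold>\<open>ADC implies maximal.\<close> It suffices that \<open>M\<close> contains an orthogonal basis of \<open>FM\<close> that splits
  into vectors \<open>X\<close> of unit norm and vectors \<open>Y\<close> such that every vector of integral norm orthogonal
  to \<open>X\<close> has integral coordinates with respect to \<open>Y\<close>. The space \<open>FM\<close> contains \<open>n - 1\<close> orthogonal
  vectors of unit norm, hence by ADC so does \<open>M\<close>; call them \<open>X\<close>. Reflections show that systems of
  orthogonal vectors with equal unit norms in \<open>M\<close> are conjugate under \<open>O(M)\<close>, so the orthogonal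
  complement of \<open>X\<close> in \<open>M\<close> represents every nonzero integer that the complement of \<open>X\<close> in \<open>FM\<close>
  represents. If the latter represents no unit, it is anisotropic, and testing with two primes in
  different square classes fills it. Otherwise \<open>X\<close> can be enlarged by one or two vectors of unit
  norm. If by two, some pair \<open>b, w\<close> of the enlarged system can be made anisotropic modulo the
  maximal ideal; this takes a third vector, which exists because \<open>n \<ge> 2\<close>. A prime represented by
  the complement of the other vectors then forces a last basis vector whose norm is a unit or a
  prime.
\<close>

section \<open>Cardinalities and dimensions\<close>

lemma card_image_le_if_coarser:
  assumes "finite (g ` A)" "\<And>x y. x \<in> A \<Longrightarrow> y \<in> A \<Longrightarrow> g x = g y \<Longrightarrow> f x = f y"
  shows "card (f ` A) \<le> card (g ` A)"
proof -
  have "f x = f (inv_into A g (g x))" if "x \<in> A" for x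
    using that by (intro assms(2)) (auto simp: f_inv_into_f inv_into_into)
  then have "f ` A \<subseteq> (\<lambda>r. f (inv_into A g r)) ` g ` A" by auto
  then show ?thesis using assms(1) surj_card_le by blast
qed

context vector_space
begin

lemma independent_extend_finite_basis:
  assumes "finite S" "V \<subseteq> span S" "independent A" "A \<subseteq> V"
  obtains b where "finite b" "A \<subseteq> b" "b \<subseteq> V" "V \<subseteq> span b" "card b = dim V"
proof -
  obtain b where b: "A \<subseteq> b" "b \<subseteq> V" "independent b" "V \<subseteq> span b"
    using maximal_independent_subset_extend[OF assms(4,3)] by blast
  moreover have "finite b"
    using independent_span_bound[OF assms(1) b(3)] b(2) assms(2) by blast
  ultimately show thesis
    using that basis_card_eq_dim by blast
qed

lemma card_independent_le_dim:
  assumes "finite S" "V \<subseteq> span S" "independent A" "A \<subseteq> V"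
  shows "card A \<le> dim V"
  using independent_extend_finite_basis[OF assms] card_mono by metis

lemma subset_span_if_dim_le_card:
  assumes "finite S" "V \<subseteq> span S" "independent A" "A \<subseteq> V" "dim V \<le> card A"
  shows "V \<subseteq> span A"
  using independent_extend_finite_basis[OF assms(1-4)] card_seteq assms(5) by metis

lemma dim_psubset:
  assumes "finite S" "V \<subseteq> span S" "subspace U" "U \<subset> V"
  shows "dim U < dim V"
proof (rule ccontr)
  assume "\<not> dim U < dim V"
  moreover obtain b where "b \<subseteq> U" "independent b" "U \<subseteq> span b" "card b = dim U"
    using basis_exists by blast
  ultimately have "V \<subseteq> span b"
    using assms by (intro subset_span_if_dim_le_card[OF assms(1,2)]) auto
  then show False
    using span_minimal[OF \<open>b \<subseteq> U\<close> assms(3)] assms(4) by blast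
qed

end

section \<open>Non-archimedean local fields\<close>

context nonarch_local_field
begin

abbreviation val_ge_infix :: "int \<Rightarrow> 'f \<Rightarrow> bool" (infix \<open>\<le>\<^sub>v\<close> 50) where
  "k \<le>\<^sub>v x \<equiv> val_ge v k x"

definition val_eq :: "int \<Rightarrow> 'f \<Rightarrow> bool" (infix \<open>=\<^sub>v\<close> 50) where
  "k =\<^sub>v x \<longleftrightarrow> x \<noteq> 0 \<and> v x = k"

lemma val_one [simp]: "v 1 = 0"
  using val_mult[of 1 1] by simp

lemma val_minus [simp]: "v (- x) = v x"
proof (cases "x = 0")
  case False
  have "v (- 1) = 0" using val_mult[of "- 1" "- 1"] by simp
  then show ?thesis using val_mult[of "- 1" x] False by simp
qed simp

lemma val_inverse: "x \<noteq> 0 \<Longrightarrow> v (inverse x) = - v x"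
  using val_mult[of x "inverse x"] by simp

lemma val_ge_zero [simp]: "k \<le>\<^sub>v 0"
  by (simp add: val_ge_def)

lemma val_ge_one [simp]: "0 \<le>\<^sub>v 1"
  by (simp add: val_ge_def)

lemma val_ge_minus [simp]: "k \<le>\<^sub>v - x \<longleftrightarrow> k \<le>\<^sub>v x"
  by (simp add: val_ge_def)

lemma val_ge_add: "k \<le>\<^sub>v x \<Longrightarrow> k \<le>\<^sub>v y \<Longrightarrow> k \<le>\<^sub>v x + y"
  using val_add[of x y] by (cases "x + y = 0"; cases "x = 0"; cases "y = 0") (auto simp: val_ge_def)

lemma val_ge_diff: "k \<le>\<^sub>v x \<Longrightarrow> k \<le>\<^sub>v y \<Longrightarrow> k \<le>\<^sub>v x - y"
  using val_ge_add[of k x "- y"] by simp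

lemma val_ge_diff_commute: "k \<le>\<^sub>v x - y \<longleftrightarrow> k \<le>\<^sub>v y - x"
  using val_ge_minus[of k "x - y"] by simp

lemma val_ge_add_cancel: "k \<le>\<^sub>v x \<Longrightarrow> k \<le>\<^sub>v x + y \<longleftrightarrow> k \<le>\<^sub>v y"
  using val_ge_add[of k x y] val_ge_diff[of k "x + y" x] by auto

lemma val_ge_diff_trans: "k \<le>\<^sub>v x - y \<Longrightarrow> k \<le>\<^sub>v y - z \<Longrightarrow> k \<le>\<^sub>v x - z"
  using val_ge_add[of k "x - y" "y - z"] by simp

lemma val_ge_mono: "k \<le>\<^sub>v x \<Longrightarrow> j \<le> k \<Longrightarrow> j \<le>\<^sub>v x"
  by (auto simp: val_ge_def)

lemma val_ge_mult: "j \<le>\<^sub>v x \<Longrightarrow> k \<le>\<^sub>v y \<Longrightarrow> j + k \<le>\<^sub>v x * y"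
  using val_mult[of x y] by (cases "x = 0"; cases "y = 0") (auto simp: val_ge_def)

lemma val_ge_mult_left: "0 \<le>\<^sub>v x \<Longrightarrow> k \<le>\<^sub>v y \<Longrightarrow> k \<le>\<^sub>v x * y"
  using val_ge_mult[of 0 x k y] by simp

lemma val_ge_mult_right: "k \<le>\<^sub>v x \<Longrightarrow> 0 \<le>\<^sub>v y \<Longrightarrow> k \<le>\<^sub>v x * y"
  using val_ge_mult[of k x 0 y] by simp

lemma val_ge_1_mult_iff: "0 \<le>\<^sub>v x \<Longrightarrow> 0 \<le>\<^sub>v y \<Longrightarrow> 1 \<le>\<^sub>v x * y \<longleftrightarrow> 1 \<le>\<^sub>v x \<or> 1 \<le>\<^sub>v y"
  by (cases "x = 0"; cases "y = 0") (auto simp: val_ge_def val_mult)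

lemma val_ge_1_square_iff: "1 \<le>\<^sub>v x * x \<longleftrightarrow> 1 \<le>\<^sub>v x"
  by (cases "x = 0") (auto simp: val_ge_def val_mult)

lemma val_ge_2_square: "1 \<le>\<^sub>v x \<Longrightarrow> 2 \<le>\<^sub>v x * x"
  using val_ge_mult[of 1 x 1 x] by simp

lemma val_ge_0_if_square_mult:
  assumes "0 \<le>\<^sub>v c * c * a" "\<not> 2 \<le>\<^sub>v a" shows "0 \<le>\<^sub>v c"
  using assms by (cases "c = 0") (auto simp: val_ge_def val_mult)

lemma zero_if_val_ge_all:
  assumes "\<And>k. k \<le>\<^sub>v x" shows "x = 0"
  using assms[of "v x + 1"] by (simp add: val_ge_def)

lemma ring_of_integers_iff: "x \<in> ring_of_integers v \<longleftrightarrow> 0 \<le>\<^sub>v x"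
  by (simp add: ring_of_integers_def)

lemma val_eq_iff: "k =\<^sub>v x \<longleftrightarrow> k \<le>\<^sub>v x \<and> \<not> k + 1 \<le>\<^sub>v x"
  by (auto simp: val_eq_def val_ge_def)

lemma val_eq_nonzero: "k =\<^sub>v x \<Longrightarrow> x \<noteq> 0"
  by (simp add: val_eq_def)

lemma val_eq_imp_val_ge: "k =\<^sub>v x \<Longrightarrow> j \<le> k \<Longrightarrow> j \<le>\<^sub>v x"
  by (simp add: val_eq_def val_ge_def)

lemma val_eq_0_one [simp]: "0 =\<^sub>v 1"
  by (simp add: val_eq_def)

lemma val_eq_minus [simp]: "k =\<^sub>v - x \<longleftrightarrow> k =\<^sub>v x"
  by (simp add: val_eq_def)

lemma val_eq_mult: "j =\<^sub>v x \<Longrightarrow> k =\<^sub>v y \<Longrightarrow> j + k =\<^sub>v x * y"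
  by (auto simp: val_eq_def val_mult)

lemma val_eq_mult_unit: "0 =\<^sub>v a \<Longrightarrow> k =\<^sub>v x \<Longrightarrow> k =\<^sub>v a * x"
  using val_eq_mult[of 0 a k x] by simp

lemma val_eq_cong: "k =\<^sub>v x \<Longrightarrow> k + 1 \<le>\<^sub>v x - y \<Longrightarrow> k =\<^sub>v y"
  unfolding val_eq_iff
  using val_ge_diff[of k x "x - y"] val_ge_add[of "k + 1" "x - y" y] val_ge_mono[of "k + 1" "x - y" k]
  by auto

lemma val_eq_add: "k =\<^sub>v x \<Longrightarrow> k + 1 \<le>\<^sub>v y \<Longrightarrow> k =\<^sub>v x + y"
  using val_eq_cong[of k x "x + y"] by simp

lemma val_eq_divide: "j =\<^sub>v x \<Longrightarrow> k =\<^sub>v y \<Longrightarrow> j - k =\<^sub>v x / y"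
  by (auto simp: val_eq_def divide_inverse val_mult val_inverse)

lemma val_ge_divide: "j \<le>\<^sub>v x \<Longrightarrow> k =\<^sub>v y \<Longrightarrow> j - k \<le>\<^sub>v x / y"
  by (cases "x = 0") (auto simp: val_ge_def val_eq_def divide_inverse val_mult val_inverse)

lemma val_ge_divide_unit: "k \<le>\<^sub>v x \<Longrightarrow> 0 =\<^sub>v a \<Longrightarrow> k \<le>\<^sub>v x / a"
  using val_ge_divide[of k x 0 a] by simp

lemma val_ge_mult_unit_iff: "0 =\<^sub>v a \<Longrightarrow> k \<le>\<^sub>v a * x \<longleftrightarrow> k \<le>\<^sub>v x"
  by (cases "x = 0") (auto simp: val_ge_def val_eq_def val_mult)

lemma finite_imp_val_bounded:
  assumes "finite A" shows "\<exists>j. \<forall>a\<in>A. j \<le>\<^sub>v a"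
proof (cases "A = {}")
  case False
  then have "Min (v ` A) \<le>\<^sub>v a" if "a \<in> A" for a
    using assms that by (simp add: val_ge_def)
  then show ?thesis by blast
qed simp

lemma val_attains_min:
  assumes "\<And>a. a \<in> A \<Longrightarrow> j \<le>\<^sub>v a" "x \<in> A" "x \<noteq> 0"
  obtains b where "b \<in> A" "b \<noteq> 0" "\<And>a. a \<in> A \<Longrightarrow> v b \<le>\<^sub>v a"
proof -
  have "x \<in> A \<and> x \<noteq> 0" using assms by simp
  then obtain b where b: "b \<in> A" "b \<noteq> 0"
    and least: "\<And>a. a \<in> A \<and> a \<noteq> 0 \<Longrightarrow> nat (v b - j) \<le> nat (v a - j)"
    using ex_has_least_nat[of "\<lambda>x. x \<in> A \<and> x \<noteq> 0" _ "\<lambda>a. nat (v a - j)"] by metis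
  have "v b \<le>\<^sub>v a" if "a \<in> A" for a
    using least[of a] assms(1)[OF that] that by (cases "a = 0") (auto simp: val_ge_def)
  with b show thesis by (rule that)
qed

definition \<pi> :: 'f where "\<pi> = (SOME x. 1 =\<^sub>v x)"

lemma val_eq_pi: "1 =\<^sub>v \<pi>"
  unfolding \<pi>_def by (rule someI_ex) (use uniformizer in \<open>simp add: val_eq_def\<close>)

lemma pi_nonzero [simp]: "\<pi> \<noteq> 0"
  using val_eq_pi by (rule val_eq_nonzero)

lemma exists_val_eq: "\<exists>c. k =\<^sub>v c"
proof -
  have power: "int i =\<^sub>v \<pi> ^ i" for i
    by (induction i) (use val_eq_mult[OF val_eq_pi] in auto)
  show ?thesis
  proof (cases "0 \<le> k")
    case True
    then show ?thesis using power[of "nat k"] by auto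
  next
    case False
    then show ?thesis using val_eq_divide[OF val_eq_0_one power[of "nat (- k)"]] by auto
  qed
qed

lemma exists_square_mult_val_0_1:
  assumes "a \<noteq> 0"
  obtains c where "0 =\<^sub>v c * c * a \<or> 1 =\<^sub>v c * c * a"
proof -
  obtain c where c: "- (v a div 2) =\<^sub>v c" using exists_val_eq by blast
  have "v a =\<^sub>v a" using assms by (simp add: val_eq_def)
  then have "- (v a div 2) + - (v a div 2) + v a =\<^sub>v c * c * a"
    by (rule val_eq_mult[OF val_eq_mult[OF c c]])
  moreover have "- (v a div 2) + - (v a div 2) + v a \<in> {0, 1}" by auto
  ultimately show thesis using that[of c] by auto
qed

lemma limit_exists:
  assumes step: "\<And>i. int i \<le>\<^sub>v s (Suc i) - s i"
  obtains L where "\<And>i. int i \<le>\<^sub>v s i - L"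
proof -
  have cauchy: "int i \<le>\<^sub>v s i - s j" if "i \<le> j" for i j
    using that
  proof (induction j rule: dec_induct)
    case (step j)
    have "int i \<le>\<^sub>v s j - s (Suc j)"
      using assms[of j] step(1) val_ge_mono val_ge_diff_commute by (metis of_nat_mono)
    with step.IH show ?case by (rule val_ge_diff_trans)
  qed simp
  have "\<exists>N. \<forall>i\<ge>N. \<forall>j\<ge>N. k \<le>\<^sub>v s i - s j" for k
  proof (intro exI allI impI)
    fix i j assume "nat k \<le> i" "nat k \<le> j"
    then have "int (nat k) \<le>\<^sub>v s i - s j"
      using cauchy val_ge_diff_trans val_ge_diff_commute by meson
    then show "k \<le>\<^sub>v s i - s j" by (rule val_ge_mono) simp
  qed
  then obtain L where L: "\<And>k. \<exists>N. \<forall>i\<ge>N. k \<le>\<^sub>v s i - L"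
    using complete by blast
  show thesis
  proof (rule that)
    fix i
    obtain N where "\<forall>j\<ge>N. int i \<le>\<^sub>v s j - L" using L by blast
    then show "int i \<le>\<^sub>v s i - L"
      using cauchy[of i "max i N"] val_ge_diff_trans by (metis max.cobounded1 max.cobounded2)
  qed
qed

subsection \<open>The residue field\<close>

definition residue :: "'f \<Rightarrow> 'f set" where
  "residue x = {y. 0 \<le>\<^sub>v y \<and> 1 \<le>\<^sub>v x - y}"

lemma residue_eq_iff:
  assumes "0 \<le>\<^sub>v x" "0 \<le>\<^sub>v y"
  shows "residue x = residue y \<longleftrightarrow> 1 \<le>\<^sub>v x - y"
proof
  assume "residue x = residue y"
  moreover have "y \<in> residue y" using assms by (simp add: residue_def)
  ultimately have "y \<in> residue x" by simp
  then show "1 \<le>\<^sub>v x - y" by (simp add: residue_def)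
next
  assume "1 \<le>\<^sub>v x - y"
  then show "residue x = residue y"
    unfolding residue_def using val_ge_diff_trans val_ge_diff_commute by blast
qed

lemma residue_field_eq: "residue_field v = residue ` ring_of_integers v"
  by (auto simp: residue_field_def quotient_def residue_def maximal_ideal_def ring_of_integers_iff)

definition residue_square :: "'f \<Rightarrow> bool" where
  "residue_square a \<longleftrightarrow> (\<exists>t. 0 \<le>\<^sub>v t \<and> 1 \<le>\<^sub>v t * t - a)"

lemma residue_square_cong: "1 \<le>\<^sub>v a - b \<Longrightarrow> residue_square a \<longleftrightarrow> residue_square b"
  unfolding residue_square_def using val_ge_diff_trans val_ge_diff_commute by blast

lemma val_eq_0_nonsquare_diff:
  assumes "\<not> residue_square a" "0 \<le>\<^sub>v a" "0 \<le>\<^sub>v t" shows "0 =\<^sub>v a - t * t"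
  using assms val_ge_mult_left[of t 0 t] val_ge_diff_commute[of 1 a]
  by (auto simp: residue_square_def val_eq_iff intro: val_ge_diff)

lemma residue_square_mult_unit_square:
  assumes "0 =\<^sub>v t" shows "residue_square (t * t * a) \<longleftrightarrow> residue_square a"
proof
  assume "residue_square (t * t * a)"
  then obtain s where s: "0 \<le>\<^sub>v s" "1 \<le>\<^sub>v s * s - t * t * a" by (auto simp: residue_square_def)
  have "1 \<le>\<^sub>v (s * s - t * t * a) / (t * t)"
    using s assms by (intro val_ge_divide_unit val_eq_mult_unit)
  also have "(s * s - t * t * a) / (t * t) = (s / t) * (s / t) - a"
    using val_eq_nonzero[OF assms] by (simp add: field_simps)
  finally show "residue_square a"
    unfolding residue_square_def using val_ge_divide_unit[OF s(1) assms] by blast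
next
  assume "residue_square a"
  then obtain s where s: "0 \<le>\<^sub>v s" "1 \<le>\<^sub>v s * s - a" by (auto simp: residue_square_def)
  have t: "0 \<le>\<^sub>v t" using assms by (rule val_eq_imp_val_ge) simp
  have "1 \<le>\<^sub>v t * t * (s * s - a)" using s t by (intro val_ge_mult_left)
  then have "1 \<le>\<^sub>v (t * s) * (t * s) - t * t * a" by (simp add: algebra_simps)
  then show "residue_square (t * t * a)"
    unfolding residue_square_def using val_ge_mult_left[OF t s(1)] by blast
qed

lemma residue_square_mult_unit:
  assumes a: "residue_square a" "0 =\<^sub>v a" and b: "0 \<le>\<^sub>v b"
  shows "residue_square (a * b) \<longleftrightarrow> residue_square b"
proof -
  obtain t where t: "0 \<le>\<^sub>v t" "1 \<le>\<^sub>v t * t - a" using a by (auto simp: residue_square_def)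
  have "0 =\<^sub>v t * t" using val_eq_cong[OF a(2)] t(2) val_ge_diff_commute by auto
  then have "0 =\<^sub>v t" using t(1) val_ge_1_square_iff by (simp add: val_eq_iff)
  have "1 \<le>\<^sub>v (t * t - a) * b" using t b by (intro val_ge_mult_right)
  then have "1 \<le>\<^sub>v t * t * b - a * b" by (simp add: algebra_simps)
  then show ?thesis
    using residue_square_cong residue_square_mult_unit_square[OF \<open>0 =\<^sub>v t\<close>] by blast
qed

lemma residue_nonsquare_exchange:
  assumes p: "0 =\<^sub>v p" "residue_square p" and r: "0 =\<^sub>v r" and s: "0 =\<^sub>v s" "1 \<le>\<^sub>v s - \<Delta> * r"
    and \<Delta>: "\<not> residue_square \<Delta>"
  shows "\<not> residue_square (p * (s * r))"
proof -
  have "1 \<le>\<^sub>v r * (s - \<Delta> * r)"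
    using val_eq_imp_val_ge[OF r] s(2) by (intro val_ge_mult_left) auto
  then have "1 \<le>\<^sub>v s * r - r * r * \<Delta>" by (simp add: algebra_simps)
  then have "\<not> residue_square (s * r)"
    using residue_square_cong residue_square_mult_unit_square[OF r] \<Delta> by blast
  moreover have "0 \<le>\<^sub>v s * r" using val_eq_imp_val_ge[OF val_eq_mult_unit[OF s(1) r]] by simp
  ultimately show ?thesis using residue_square_mult_unit[OF p(2,1)] by blast
qed

lemma binary_form_residue_anisotropic:
  assumes "0 =\<^sub>v a" "0 =\<^sub>v b" and aniso: "\<not> residue_square (- (a * b))"
    and "0 \<le>\<^sub>v x" "0 \<le>\<^sub>v y" and isotropic: "1 \<le>\<^sub>v a * (x * x) + b * (y * y)"
  shows "1 \<le>\<^sub>v x \<and> 1 \<le>\<^sub>v y"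
proof -
  have a: "0 \<le>\<^sub>v a" and b: "0 \<le>\<^sub>v b" using assms(1,2) by (auto intro: val_eq_imp_val_ge)
  have x: "1 \<le>\<^sub>v x"
  proof (rule ccontr)
    assume "\<not> 1 \<le>\<^sub>v x"
    then have "0 =\<^sub>v x" using assms by (simp add: val_eq_iff)
    have "1 \<le>\<^sub>v b * (a * (x * x) + b * (y * y))" using b isotropic by (rule val_ge_mult_left)
    also have "b * (a * (x * x) + b * (y * y)) = (b * y) * (b * y) - x * x * (- (a * b))"
      by (simp add: algebra_simps)
    finally have "residue_square (x * x * (- (a * b)))"
      using b assms(5) by (auto simp: residue_square_def intro: val_ge_mult_left)
    then show False using aniso residue_square_mult_unit_square[OF \<open>0 =\<^sub>v x\<close>] by blast
  qed
  then have "1 \<le>\<^sub>v a * (x * x)" using a val_ge_1_square_iff by (auto intro: val_ge_mult_left)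
  then have "1 \<le>\<^sub>v b * (y * y)" using isotropic by (simp add: val_ge_add_cancel)
  then show ?thesis using x assms by (simp add: val_ge_mult_unit_iff val_ge_1_square_iff)
qed

lemma anisotropic_prime_remainder:
  assumes ab: "0 =\<^sub>v a" "0 =\<^sub>v b" "\<not> residue_square (- (a * b))" and xy: "0 \<le>\<^sub>v x" "0 \<le>\<^sub>v y"
    and prime: "1 =\<^sub>v a * (x * x) + b * (y * y) + r"
  shows "\<not> 2 \<le>\<^sub>v r"
proof
  assume r: "2 \<le>\<^sub>v r"
  then have "1 \<le>\<^sub>v a * (x * x) + b * (y * y) + r - r"
    using prime val_ge_mono[of 2 _ 1] by (intro val_ge_diff) (auto simp: val_eq_iff)
  then have "1 \<le>\<^sub>v x \<and> 1 \<le>\<^sub>v y" using binary_form_residue_anisotropic[OF ab xy] by simp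
  then have "2 \<le>\<^sub>v a * (x * x) + b * (y * y) + r"
    using ab r by (intro val_ge_add) (simp_all add: val_ge_mult_unit_iff val_ge_2_square)
  then show False using prime by (simp add: val_eq_iff)
qed

definition square_residues :: "'f set set" where
  "square_residues = (\<lambda>x. residue (x * x)) ` ring_of_integers v"

lemma val_ge_1_square_diff_iff:
  assumes "0 \<le>\<^sub>v x" "0 \<le>\<^sub>v y"
  shows "1 \<le>\<^sub>v x * x - y * y \<longleftrightarrow> 1 \<le>\<^sub>v x - y \<or> 1 \<le>\<^sub>v x + y"
  using val_ge_1_mult_iff[of "x - y" "x + y"] assms val_ge_add val_ge_diff by (simp add: algebra_simps)

lemma residue_square_eq_iff:
  assumes "0 \<le>\<^sub>v x" "0 \<le>\<^sub>v y"
  shows "residue (x * x) = residue (y * y) \<longleftrightarrow> residue x = residue y \<or> residue x = residue (- y)"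
  using assms by (simp add: residue_eq_iff val_ge_1_square_diff_iff val_ge_mult_left)

lemma square_residues_subset: "square_residues \<subseteq> residue_field v"
  by (auto simp: square_residues_def residue_field_eq ring_of_integers_iff val_ge_mult_left)

lemma residue_root_exists:
  obtains root where "\<And>s. s \<in> square_residues \<Longrightarrow> 0 \<le>\<^sub>v root s"
    "\<And>s. s \<in> square_residues \<Longrightarrow> residue (root s * root s) = s"
proof -
  have "\<forall>s\<in>square_residues. \<exists>x. 0 \<le>\<^sub>v x \<and> residue (x * x) = s"
    by (auto simp: square_residues_def ring_of_integers_iff)
  then show thesis using that by metis
qed

lemma card_residue_field_less: "card (residue_field v) < 2 * card square_residues"
proof -
  have finite: "finite square_residues"
    using square_residues_subset finite_residue_field by (rule finite_subset)
  obtain root where root: "\<And>s. s \<in> square_residues \<Longrightarrow> 0 \<le>\<^sub>v root s"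
    "\<And>s. s \<in> square_residues \<Longrightarrow> residue (root s * root s) = s"
    using residue_root_exists by blast
  define P where "P = (\<lambda>s. residue (root s)) ` square_residues"
  define N where "N = (\<lambda>s. residue (- root s)) ` square_residues"
  have "residue_field v \<subseteq> P \<union> N"
  proof
    fix r assume "r \<in> residue_field v"
    then obtain x where x: "0 \<le>\<^sub>v x" "r = residue x"
      by (auto simp: residue_field_eq ring_of_integers_iff)
    have s: "residue (x * x) \<in> square_residues"
      using x by (simp add: square_residues_def ring_of_integers_iff)
    then have "r = residue (root (residue (x * x))) \<or> r = residue (- root (residue (x * x)))"
      using root(1)[OF s] root(2)[OF s] residue_square_eq_iff x by metis
    then show "r \<in> P \<union> N" unfolding P_def N_def using s by blast
  qed
  moreover have finite_PN: "finite P" "finite N" using finite by (simp_all add: P_def N_def)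
  ultimately have "card (residue_field v) \<le> card (P \<union> N)" by (intro card_mono) auto
  moreover have "0 < card (P \<inter> N)"
  proof -
    have zero: "residue 0 \<in> square_residues"
      unfolding square_residues_def by (rule image_eqI[of _ _ 0]) (auto simp: ring_of_integers_iff)
    then have "residue (root (residue 0)) = residue 0" "residue (- root (residue 0)) = residue 0"
      using root(1)[OF zero] root(2)[OF zero]
      by (auto simp: residue_eq_iff val_ge_mult_left val_ge_1_square_iff)
    then have "residue 0 \<in> P \<inter> N"
      unfolding P_def N_def by (intro IntI image_eqI[OF _ zero]) simp_all
    then show ?thesis using finite_PN by (auto simp: card_gt_0_iff)
  qed
  moreover have "card P + card N = card (P \<union> N) + card (P \<inter> N)"
    using finite_PN by (rule card_Un_Int)
  moreover have "card P \<le> card square_residues" "card N \<le> card square_residues"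
    using finite by (simp_all add: P_def N_def card_image_le)
  ultimately show ?thesis by linarith
qed

lemma card_square_residues_le:
  assumes "\<And>x. 0 \<le>\<^sub>v x \<Longrightarrow> 0 \<le>\<^sub>v e x"
    and "\<And>x y. 0 \<le>\<^sub>v x \<Longrightarrow> 0 \<le>\<^sub>v y \<Longrightarrow> 1 \<le>\<^sub>v e x - e y \<Longrightarrow> 1 \<le>\<^sub>v x * x - y * y"
  shows "card square_residues \<le> card ((\<lambda>x. residue (e x)) ` ring_of_integers v)"
  unfolding square_residues_def
proof (rule card_image_le_if_coarser)
  have "(\<lambda>x. residue (e x)) ` ring_of_integers v \<subseteq> residue_field v"
    using assms(1) by (auto simp: residue_field_eq ring_of_integers_iff)
  then show "finite ((\<lambda>x. residue (e x)) ` ring_of_integers v)"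
    using finite_residue_field by (rule finite_subset)
  fix x y assume "x \<in> ring_of_integers v" "y \<in> ring_of_integers v" "residue (e x) = residue (e y)"
  then show "residue (x * x) = residue (y * y)"
    using assms by (simp add: ring_of_integers_iff residue_eq_iff val_ge_mult_left)
qed

text \<open>Pigeonhole: both sides of \<open>a x\<^sup>2 = c - b y\<^sup>2\<close> take more than half of the residue classes.\<close>

lemma unit_binary_form_represents:
  assumes a: "0 =\<^sub>v a" and b: "0 =\<^sub>v b" and c: "0 \<le>\<^sub>v c"
  obtains x y where "0 \<le>\<^sub>v x" "0 \<le>\<^sub>v y" "1 \<le>\<^sub>v a * (x * x) + b * (y * y) - c"
proof -
  define P where "P = (\<lambda>x. residue (a * (x * x))) ` ring_of_integers v"
  define N where "N = (\<lambda>y. residue (c - b * (y * y))) ` ring_of_integers v"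
  have integral: "0 \<le>\<^sub>v a * (x * x)" "0 \<le>\<^sub>v c - b * (x * x)" if "0 \<le>\<^sub>v x" for x
    using val_ge_mult_left[OF that that] a b c by (simp_all add: val_ge_mult_unit_iff val_ge_diff)
  then have PN: "P \<union> N \<subseteq> residue_field v"
    by (auto simp: P_def N_def residue_field_eq ring_of_integers_iff)
  then have finite: "finite P" "finite N" using finite_residue_field finite_subset by auto
  have "card square_residues \<le> card P"
    unfolding P_def
  proof (rule card_square_residues_le[OF integral(1)])
    fix x y assume "1 \<le>\<^sub>v a * (x * x) - a * (y * y)"
    then have "1 \<le>\<^sub>v a * (x * x - y * y)" by (simp add: algebra_simps)
    then show "1 \<le>\<^sub>v x * x - y * y" using a by (simp add: val_ge_mult_unit_iff)
  qed
  moreover have "card square_residues \<le> card N"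
    unfolding N_def
  proof (rule card_square_residues_le[OF integral(2)])
    fix x y assume "1 \<le>\<^sub>v c - b * (x * x) - (c - b * (y * y))"
    then have "1 \<le>\<^sub>v b * (y * y - x * x)" by (simp add: algebra_simps)
    then show "1 \<le>\<^sub>v x * x - y * y" using b by (simp add: val_ge_mult_unit_iff val_ge_diff_commute)
  qed
  moreover have "card (P \<union> N) \<le> card (residue_field v)"
    using finite_residue_field PN by (rule card_mono)
  ultimately have "P \<inter> N \<noteq> {}"
    using card_residue_field_less card_Un_disjoint[OF finite] by linarith
  then obtain x y where xy: "0 \<le>\<^sub>v x" "0 \<le>\<^sub>v y" "residue (a * (x * x)) = residue (c - b * (y * y))"
    by (auto simp: P_def N_def ring_of_integers_iff)
  then have "1 \<le>\<^sub>v a * (x * x) - (c - b * (y * y))" using integral by (simp add: residue_eq_iff)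
  then show thesis using that[OF xy(1,2)] by (simp add: algebra_simps)
qed

lemma binary_form_represents:
  assumes a: "k =\<^sub>v a" and b: "k =\<^sub>v b" and c: "k \<le>\<^sub>v c"
  obtains x y where "0 \<le>\<^sub>v x" "0 \<le>\<^sub>v y" "k + 1 \<le>\<^sub>v a * (x * x) + b * (y * y) - c"
proof -
  obtain d where d: "k =\<^sub>v d" using exists_val_eq by blast
  have "0 =\<^sub>v a / d" "0 =\<^sub>v b / d" "0 \<le>\<^sub>v c / d"
    using val_eq_divide[OF a d] val_eq_divide[OF b d] val_ge_divide[OF c d] by simp_all
  then obtain x y where xy: "0 \<le>\<^sub>v x" "0 \<le>\<^sub>v y" "1 \<le>\<^sub>v a / d * (x * x) + b / d * (y * y) - c / d"
    by (rule unit_binary_form_represents)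
  have "k + 1 \<le>\<^sub>v d * (a / d * (x * x) + b / d * (y * y) - c / d)"
    using val_eq_imp_val_ge[OF d order_refl] xy(3) by (rule val_ge_mult)
  also have "d * (a / d * (x * x) + b / d * (y * y) - c / d) = a * (x * x) + b * (y * y) - c"
    using val_eq_nonzero[OF d] by (simp add: field_simps)
  finally show thesis using that xy(1,2) by blast
qed

end

section \<open>Non-dyadic local fields\<close>

locale nondyadic_local_field = nonarch_local_field v for v :: "'f::field \<Rightarrow> int" +
  assumes non_dyadic: "non_dyadic v"
begin

lemma val_eq_0_two: "0 =\<^sub>v 2"
proof -
  obtain y where y: "0 \<le>\<^sub>v (2 :: 'f)" "0 \<le>\<^sub>v y" "2 * y = 1"
    using non_dyadic by (auto simp: non_dyadic_def integer_units_def ring_of_integers_iff)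
  have "\<not> 1 \<le>\<^sub>v (2 :: 'f)"
    using val_ge_mult_right[of 1 2 y] y by (auto simp: val_ge_def)
  with y show ?thesis by (simp add: val_eq_iff)
qed

lemma two_nonzero [simp]: "(2 :: 'f) \<noteq> 0"
  using val_eq_0_two by (rule val_eq_nonzero)

lemma four_nonzero [simp]: "(4 :: 'f) \<noteq> 0"
  using mult_eq_0_iff[of 2 "2 :: 'f"] by simp

lemma val_ge_half: "k \<le>\<^sub>v x \<Longrightarrow> k \<le>\<^sub>v x / 2"
  using val_eq_0_two by (rule val_ge_divide_unit[rotated])

subsection \<open>Square roots\<close>

lemma newton_sqrt_step:
  assumes s: "1 \<le>\<^sub>v s - 1" and k: "k \<le>\<^sub>v s * s - a" "1 \<le> k"
    and t: "t = s - (s * s - a) / 2"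
  shows "1 \<le>\<^sub>v t - 1" "k + 1 \<le>\<^sub>v t * t - a" "k \<le>\<^sub>v t - s"
proof -
  define e where "e = s * s - a"
  have e: "k \<le>\<^sub>v e / 2" "1 \<le>\<^sub>v e / 2"
    using k val_ge_mono[of k _ 1] by (auto simp: e_def intro: val_ge_half)
  show "1 \<le>\<^sub>v t - 1"
    using val_ge_diff[OF s e(2)] by (simp add: t e_def algebra_simps)
  show "k \<le>\<^sub>v t - s" using e(1) by (simp add: t e_def val_ge_diff_commute)
  have "k + 1 \<le>\<^sub>v e * (1 - s)"
    using k(1) s val_ge_diff_commute unfolding e_def by (intro val_ge_mult) auto
  moreover have "k + 1 \<le>\<^sub>v e / 2 * (e / 2)" using e by (rule val_ge_mult)
  ultimately have "k + 1 \<le>\<^sub>v e * (1 - s) + e / 2 * (e / 2)" by (rule val_ge_add)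
  also have "e * (1 - s) + e / 2 * (e / 2) = t * t - a"
    by (simp add: t e_def field_simps)
  finally show "k + 1 \<le>\<^sub>v t * t - a" .
qed

lemma sqrt_if_val_ge_1_minus_1:
  assumes a: "1 \<le>\<^sub>v a - 1"
  obtains s where "s * s = a" "1 \<le>\<^sub>v s - 1"
proof -
  define s where "s = rec_nat 1 (\<lambda>_ s. s - (s * s - a) / 2)"
  have s_Suc: "s (Suc i) = s i - (s i * s i - a) / 2" for i by (simp add: s_def)
  have s: "1 \<le>\<^sub>v s i - 1 \<and> int i + 1 \<le>\<^sub>v s i * s i - a" for i
  proof (induction i)
    case 0
    then show ?case using a by (simp add: s_def val_ge_diff_commute)
  next
    case (Suc i)
    then show ?case using newton_sqrt_step[of "s i" "int i + 1" a] s_Suc by (simp add: add.commute)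
  qed
  have "int i \<le>\<^sub>v s (Suc i) - s i" for i
    using newton_sqrt_step(3)[of "s i" "int i + 1" a] s[of i] s_Suc val_ge_mono by force
  then obtain L where L: "\<And>i. int i \<le>\<^sub>v s i - L" using limit_exists by blast
  have L_1: "1 \<le>\<^sub>v L - 1"
    using L[of 1] s[of 1] val_ge_diff_trans val_ge_diff_commute by (metis of_nat_1)
  have "int i \<le>\<^sub>v L * L - a" for i
  proof -
    have "0 \<le>\<^sub>v (L - 1) + (s i - 1) + 2"
      using L_1 s[of i] val_eq_imp_val_ge[OF val_eq_0_two]
      by (intro val_ge_add) (auto intro: val_ge_mono)
    then have "int i \<le>\<^sub>v (s i - L) * (s i + L)"
      using L by (intro val_ge_mult_right) (auto simp: algebra_simps)
    moreover have "int i \<le>\<^sub>v s i * s i - a" using s[of i] by (auto intro: val_ge_mono)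
    ultimately have "int i \<le>\<^sub>v s i * s i - a - (s i - L) * (s i + L)" by (rule val_ge_diff[rotated])
    then show ?thesis by (simp add: algebra_simps)
  qed
  then have "k \<le>\<^sub>v L * L - a" for k
    by (rule val_ge_mono[of "int (nat k)"]) simp
  then have "L * L - a = 0" by (rule zero_if_val_ge_all)
  then show thesis using that L_1 by simp
qed

lemma integral_root_quadratic:
  assumes "0 \<le>\<^sub>v a" "1 \<le>\<^sub>v c"
  obtains t where "0 \<le>\<^sub>v t" "a + 2 * t + t * t * c = 0"
proof -
  have "1 \<le>\<^sub>v (1 - a * c) - 1" using assms by (auto intro: val_ge_mult_left)
  then obtain s where s: "s * s = 1 - a * c" "1 \<le>\<^sub>v s - 1" using sqrt_if_val_ge_1_minus_1 by blast
  have "0 =\<^sub>v 1 + s"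
    using val_eq_add[OF val_eq_0_two, of "s - 1"] s(2) by simp
  define t where "t = - a / (1 + s)"
  have t_mult: "t * (1 + s) = - a" using val_eq_nonzero[OF \<open>0 =\<^sub>v 1 + s\<close>] by (simp add: t_def)
  have "(a + 2 * t + t * t * c) * ((1 + s) * (1 + s)) =
      a * ((1 + s) * (1 + s)) + 2 * (t * (1 + s)) * (1 + s) + (t * (1 + s)) * (t * (1 + s)) * c"
    by (simp add: algebra_simps)
  also have "\<dots> = a * (s * s - (1 - a * c))"
    unfolding t_mult by (simp add: algebra_simps)
  finally have "a + 2 * t + t * t * c = 0" using val_eq_nonzero[OF \<open>0 =\<^sub>v 1 + s\<close>] s(1) by simp
  moreover have "0 \<le>\<^sub>v t"
    unfolding t_def using assms(1) \<open>0 =\<^sub>v 1 + s\<close> by (intro val_ge_divide_unit) auto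
  ultimately show thesis using that by blast
qed

subsection \<open>Non-squares in the residue field\<close>

lemma square_residues_neq: "square_residues \<noteq> residue_field v"
proof
  assume squares: "square_residues = residue_field v"
  obtain root where root: "\<And>r. r \<in> residue_field v \<Longrightarrow> 0 \<le>\<^sub>v root r"
    "\<And>r. r \<in> residue_field v \<Longrightarrow> residue (root r * root r) = r"
    using residue_root_exists unfolding squares by blast
  have root_unique: "residue (root r) = residue x \<Longrightarrow> r = residue (x * x)"
    if "r \<in> residue_field v" "0 \<le>\<^sub>v x" for r x
    using root(1)[OF that(1)] root(2)[OF that(1)] that residue_square_eq_iff by metis
  define f where "f r = residue (root r)" for r
  have "f ` residue_field v \<subseteq> residue_field v"
    using root by (auto simp: f_def residue_field_eq ring_of_integers_iff)
  moreover have "inj_on f (residue_field v)"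
  proof (rule inj_onI)
    fix r s assume "r \<in> residue_field v" "s \<in> residue_field v" "f r = f s"
    then show "r = s" using root root_unique[of s "root r"] by (simp add: f_def)
  qed
  ultimately have "f ` residue_field v = residue_field v"
    using finite_residue_field by (rule endo_inj_surj[rotated])
  moreover have "residue 1 \<in> residue_field v" "residue (- 1) \<in> residue_field v"
    by (auto simp: residue_field_eq ring_of_integers_iff)
  ultimately have "residue 1 \<in> f ` residue_field v" "residue (- 1) \<in> f ` residue_field v"
    by simp_all
  then obtain r s where rs: "r \<in> residue_field v" "residue 1 = residue (root r)"
    "s \<in> residue_field v" "residue (- 1) = residue (root s)"
    by (auto simp: f_def)
  then have "r = s" using root_unique[of r 1] root_unique[of s "- 1"] by simp
  then have "1 \<le>\<^sub>v (2 :: 'f)" using rs residue_eq_iff[of 1 "- 1"] by simp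
  then show False using val_eq_0_two by (simp add: val_eq_iff)
qed

lemma residue_nonsquare_exists:
  obtains \<Delta> where "0 =\<^sub>v \<Delta>" "\<not> residue_square \<Delta>"
proof -
  obtain r where "r \<in> residue_field v" "r \<notin> square_residues"
    using square_residues_neq square_residues_subset by blast
  then obtain \<Delta> where \<Delta>: "0 \<le>\<^sub>v \<Delta>" "residue \<Delta> \<notin> square_residues"
    by (auto simp: residue_field_eq ring_of_integers_iff)
  have "\<not> residue_square \<Delta>"
  proof
    assume "residue_square \<Delta>"
    then obtain t where t: "0 \<le>\<^sub>v t" "1 \<le>\<^sub>v t * t - \<Delta>" by (auto simp: residue_square_def)
    then have "residue \<Delta> = residue (t * t)"
      using \<Delta>(1) by (simp add: residue_eq_iff val_ge_mult_left val_ge_diff_commute)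
    then show False using t(1) \<Delta>(2) by (simp add: square_residues_def ring_of_integers_iff)
  qed
  then show thesis using that[of \<Delta>] val_eq_0_nonsquare_diff[of \<Delta> 0] \<Delta>(1) by simp
qed

end

section \<open>Modules over the ring of integers\<close>

locale valued_vector_space = nonarch_local_field v + vector_space scale
  for v :: "'f::field \<Rightarrow> int" and scale :: "'f \<Rightarrow> 'v::ab_group_add \<Rightarrow> 'v" (infixr \<open>*s\<close> 75)
begin

definition integer_submodule :: "'v set \<Rightarrow> bool" where
  "integer_submodule K \<longleftrightarrow>
     0 \<in> K \<and> (\<forall>x\<in>K. \<forall>y\<in>K. x + y \<in> K) \<and> (\<forall>c. \<forall>x\<in>K. 0 \<le>\<^sub>v c \<longrightarrow> c *s x \<in> K)"

lemma integer_submodule_zero: "integer_submodule K \<Longrightarrow> 0 \<in> K"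
  and integer_submodule_add: "integer_submodule K \<Longrightarrow> x \<in> K \<Longrightarrow> y \<in> K \<Longrightarrow> x + y \<in> K"
  and integer_submodule_scale: "integer_submodule K \<Longrightarrow> 0 \<le>\<^sub>v c \<Longrightarrow> x \<in> K \<Longrightarrow> c *s x \<in> K"
  by (auto simp: integer_submodule_def)

lemma integer_submodule_minus: "integer_submodule K \<Longrightarrow> x \<in> K \<Longrightarrow> - x \<in> K"
  using integer_submodule_scale[of K "- 1" x] by simp

lemma integer_submodule_diff: "integer_submodule K \<Longrightarrow> x \<in> K \<Longrightarrow> y \<in> K \<Longrightarrow> x - y \<in> K"
  using integer_submodule_add[of K x "- y"] integer_submodule_minus[of K y] by simp

lemma integer_submodule_sum:
  "integer_submodule K \<Longrightarrow> (\<And>x. x \<in> T \<Longrightarrow> f x \<in> K) \<Longrightarrow> sum f T \<in> K"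
  by (induction T rule: infinite_finite_induct)
     (auto simp: integer_submodule_zero integer_submodule_add)

lemma subspace_imp_integer_submodule: "subspace W \<Longrightarrow> integer_submodule W"
  by (simp add: integer_submodule_def subspace_def)

lemma integer_submodule_Int:
  "integer_submodule K \<Longrightarrow> integer_submodule L \<Longrightarrow> integer_submodule (K \<inter> L)"
  by (simp add: integer_submodule_def)

lemma integer_span_minimal:
  assumes K: "integer_submodule K" and "S \<subseteq> K" shows "integer_span v (*s) S \<subseteq> K"
proof
  fix x assume "x \<in> integer_span v (*s) S"
  then obtain T c where T: "T \<subseteq> S" "\<forall>a\<in>T. 0 \<le>\<^sub>v c a" "x = (\<Sum>a\<in>T. c a *s a)"
    unfolding integer_span_def ring_of_integers_iff by blast
  then have "c a *s a \<in> K" if "a \<in> T" for a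
    using that assms by (auto intro: integer_submodule_scale)
  then show "x \<in> K" unfolding T(3) by (rule integer_submodule_sum[OF K])
qed

lemma integer_span_superset: "S \<subseteq> integer_span v (*s) S"
proof
  fix x assume "x \<in> S"
  then show "x \<in> integer_span v (*s) S"
    unfolding integer_span_def ring_of_integers_iff
    by (auto intro!: exI[of _ "{x}"] exI[of _ "\<lambda>_. 1"])
qed

lemma integer_submodule_integer_span: "integer_submodule (integer_span v (*s) S)"
  unfolding integer_submodule_def
proof (intro conjI ballI allI impI)
  show "0 \<in> integer_span v (*s) S"
    unfolding integer_span_def by (force intro: exI[of _ "{}"])
next
  fix x y assume "x \<in> integer_span v (*s) S" "y \<in> integer_span v (*s) S"
  then obtain T c U d where T: "finite T" "T \<subseteq> S" "\<forall>a\<in>T. 0 \<le>\<^sub>v c a" "x = (\<Sum>a\<in>T. c a *s a)"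
    and U: "finite U" "U \<subseteq> S" "\<forall>a\<in>U. 0 \<le>\<^sub>v d a" "y = (\<Sum>a\<in>U. d a *s a)"
    unfolding integer_span_def ring_of_integers_iff by blast
  define c' d' where "c' a = (if a \<in> T then c a else 0)" and "d' a = (if a \<in> U then d a else 0)" for a
  have "x = (\<Sum>a\<in>T \<union> U. c' a *s a)" "y = (\<Sum>a\<in>T \<union> U. d' a *s a)"
    unfolding T U c'_def d'_def using T(1) U(1) by (auto intro!: sum.mono_neutral_cong_left)
  then have "x + y = (\<Sum>a\<in>T \<union> U. (c' a + d' a) *s a)"
    by (simp add: scale_left_distrib sum.distrib)
  moreover have "\<forall>a\<in>T \<union> U. 0 \<le>\<^sub>v c' a + d' a"
    using T U by (auto simp: c'_def d'_def val_ge_add)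
  ultimately show "x + y \<in> integer_span v (*s) S"
    unfolding integer_span_def ring_of_integers_iff using T U
    by (auto intro!: exI[of _ "T \<union> U"] exI[of _ "\<lambda>a. c' a + d' a"])
next
  fix e x assume "x \<in> integer_span v (*s) S" and e: "0 \<le>\<^sub>v e"
  then obtain T c where T: "finite T" "T \<subseteq> S" "\<forall>a\<in>T. 0 \<le>\<^sub>v c a" "x = (\<Sum>a\<in>T. c a *s a)"
    unfolding integer_span_def ring_of_integers_iff by blast
  have "e *s x = (\<Sum>a\<in>T. (e * c a) *s a)" by (simp add: T scale_sum_right)
  then show "e *s x \<in> integer_span v (*s) S"
    unfolding integer_span_def ring_of_integers_iff using T e
    by (auto intro!: exI[of _ T] exI[of _ "\<lambda>a. e * c a"] val_ge_mult_left)
qed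

lemma span_integer_span: "span (integer_span v (*s) S) = span S"
proof -
  have "integer_span v (*s) S \<subseteq> span S"
    by (intro integer_span_minimal subspace_imp_integer_submodule subspace_span span_superset)
  then show ?thesis
    using integer_span_superset[of S] span_mono span_minimal subspace_span
    by (meson subset_antisym)
qed

end

lemma integer_submodule_linear_image:
  assumes f: "Vector_Spaces.linear s1 s2 f"
    and K: "valued_vector_space v s1" "valued_vector_space.integer_submodule v s1 K"
  shows "valued_vector_space.integer_submodule v s2 (f ` K)"
proof -
  interpret f: Vector_Spaces.linear s1 s2 f by fact
  interpret D: valued_vector_space v s1 by fact
  interpret C: valued_vector_space v s2 ..
  show ?thesis
    unfolding C.integer_submodule_def
  proof (intro conjI ballI allI impI)
    show "0 \<in> f ` K" using D.integer_submodule_zero[OF K(2)] f.zero by (metis image_eqI)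
    fix x y assume "x \<in> f ` K" "y \<in> f ` K"
    then show "x + y \<in> f ` K"
      using D.integer_submodule_add[OF K(2)] by (auto simp flip: f.add)
  next
    fix c x assume "x \<in> f ` K" "val_ge v 0 c"
    then show "s2 c x \<in> f ` K"
      using D.integer_submodule_scale[OF K(2)] by (auto simp flip: f.scale)
  qed
qed

lemma integer_span_linear_image:
  assumes f: "Vector_Spaces.linear s1 s2 f" and v: "valued_vector_space v s1"
  shows "f ` integer_span v s1 S = integer_span v s2 (f ` S)"
proof -
  interpret f: Vector_Spaces.linear s1 s2 f by fact
  interpret D: valued_vector_space v s1 by fact
  interpret C: valued_vector_space v s2 ..
  have "integer_span v s1 S \<subseteq> {x. f x \<in> integer_span v s2 (f ` S)}"
    using C.integer_submodule_integer_span[of "f ` S"] C.integer_span_superset[of "f ` S"]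
    by (intro D.integer_span_minimal)
       (auto simp: D.integer_submodule_def C.integer_submodule_def f.zero f.add f.scale)
  moreover have "integer_span v s2 (f ` S) \<subseteq> f ` integer_span v s1 S"
    using D.integer_span_superset
    by (intro C.integer_span_minimal integer_submodule_linear_image[OF f v]
        D.integer_submodule_integer_span image_mono)
  ultimately show ?thesis by blast
qed

lemma (in nonarch_local_field) norm_ideal_integral_iff:
  "norm_ideal v B K \<subseteq> ring_of_integers v \<longleftrightarrow> (\<forall>x\<in>K. 0 \<le>\<^sub>v B x x)"
proof -
  interpret F: valued_vector_space v "(*) :: 'f \<Rightarrow> 'f \<Rightarrow> 'f"
    by unfold_locales (auto simp: algebra_simps)
  have "F.integer_submodule (ring_of_integers v)"
    by (auto simp: F.integer_submodule_def ring_of_integers_iff val_ge_add val_ge_mult_left)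
  then have "norm_ideal v B K \<subseteq> ring_of_integers v \<longleftrightarrow> {B x x |x. x \<in> K} \<subseteq> ring_of_integers v"
    unfolding norm_ideal_def using F.integer_span_minimal F.integer_span_superset
    by (meson subset_trans)
  then show ?thesis by (auto simp: ring_of_integers_iff)
qed

section \<open>Quadratic spaces over a non-dyadic local field\<close>

locale quadratic_ambient = nondyadic_local_field v + valued_vector_space v scale
  for v :: "'f::field \<Rightarrow> int" and scale :: "'f \<Rightarrow> 'v::ab_group_add \<Rightarrow> 'v" (infixr \<open>*s\<close> 75) +
  fixes B :: "'v \<Rightarrow> 'v \<Rightarrow> 'f"
  assumes B_commute: "B x y = B y x"
    and B_add_left: "B (x + y) z = B x z + B y z"
    and B_scale_left: "B (c *s x) y = c * B x y"
begin

abbreviation Q :: "'v \<Rightarrow> 'f" where "Q x \<equiv> B x x"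

lemma B_add_right: "B z (x + y) = B z x + B z y"
  using B_add_left B_commute by metis

lemma B_scale_right: "B y (c *s x) = c * B y x"
  using B_scale_left B_commute by metis

lemma B_zero_left [simp]: "B 0 x = 0"
  using B_scale_left[of 0 0 x] by simp

lemma B_zero_right [simp]: "B x 0 = 0"
  using B_commute[of x 0] by simp

lemma B_minus_left: "B (- x) y = - B x y"
  using B_scale_left[of "- 1" x y] by simp

lemma B_minus_right: "B x (- y) = - B x y"
  using B_scale_right[of x "- 1" y] by simp

lemma B_diff_left: "B (x - y) z = B x z - B y z"
  using B_add_left[of x "- y" z] by (simp add: B_minus_left)

lemma B_diff_right: "B z (x - y) = B z x - B z y"
  using B_add_right[of z x "- y"] by (simp add: B_minus_right)

lemmas B_simps = B_add_left B_add_right B_scale_left B_scale_right B_minus_left B_minus_right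
  B_diff_left B_diff_right

lemma B_sum_left: "B (sum f A) y = (\<Sum>a\<in>A. B (f a) y)"
  by (induction A rule: infinite_finite_induct) (auto simp: B_simps)

lemma polarization: "2 * B x y = Q (x + y) - Q x - Q y"
  by (simp add: B_simps B_commute[of y x])

definition perp :: "'v set \<Rightarrow> 'v set" where
  "perp X = {z. \<forall>x\<in>X. B z x = 0}"

lemma perp_empty [simp]: "perp {} = UNIV"
  by (simp add: perp_def)

lemma mem_perp_insert [simp]: "z \<in> perp (insert a X) \<longleftrightarrow> B z a = 0 \<and> z \<in> perp X"
  by (auto simp: perp_def)

lemma perp_antimono: "X \<subseteq> Y \<Longrightarrow> perp Y \<subseteq> perp X"
  by (auto simp: perp_def)

lemma subspace_perp: "subspace (perp X)"
  by (auto simp: subspace_def perp_def B_simps)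

definition integral_submodule :: "'v set \<Rightarrow> bool" where
  "integral_submodule K \<longleftrightarrow> integer_submodule K \<and> (\<forall>x\<in>K. 0 \<le>\<^sub>v Q x)"

lemma integral_submodule_imp_integer: "integral_submodule K \<Longrightarrow> integer_submodule K"
  and integral_submodule_Q: "integral_submodule K \<Longrightarrow> x \<in> K \<Longrightarrow> 0 \<le>\<^sub>v Q x"
  by (auto simp: integral_submodule_def)

lemma integral_submodule_B:
  assumes K: "integral_submodule K" and xy: "x \<in> K" "y \<in> K"
  shows "0 \<le>\<^sub>v B x y"
proof -
  have "x + y \<in> K" using K xy by (simp add: integral_submodule_def integer_submodule_add)
  then have "0 \<le>\<^sub>v Q (x + y) - Q x - Q y"
    using integral_submodule_Q[OF K] xy by (intro val_ge_diff)
  then have "0 \<le>\<^sub>v 2 * B x y" by (simp only: polarization)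
  then show ?thesis by (simp add: val_ge_mult_unit_iff val_eq_0_two)
qed

lemma integer_span_B:
  assumes ST: "\<And>s t. s \<in> S \<Longrightarrow> t \<in> T \<Longrightarrow> j \<le>\<^sub>v B s t"
    and x: "x \<in> integer_span v (*s) S" and y: "y \<in> integer_span v (*s) T"
  shows "j \<le>\<^sub>v B x y"
proof -
  have "integer_span v (*s) S \<subseteq> {x. \<forall>t\<in>T. j \<le>\<^sub>v B x t}"
    using ST by (intro integer_span_minimal)
      (auto simp: integer_submodule_def B_simps val_ge_add val_ge_mult_left)
  then have "integer_span v (*s) T \<subseteq> {y. j \<le>\<^sub>v B x y}"
    using x by (intro integer_span_minimal)
      (auto simp: integer_submodule_def B_simps val_ge_add val_ge_mult_left)
  then show ?thesis using y by blast
qed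

lemma integral_submodule_integer_span:
  assumes "\<And>s t. s \<in> S \<Longrightarrow> t \<in> S \<Longrightarrow> 0 \<le>\<^sub>v B s t"
  shows "integral_submodule (integer_span v (*s) S)"
  using integer_span_B[of S S 0] assms
  by (simp add: integral_submodule_def integer_submodule_integer_span)

lemma integral_submodule_iff_lattice:
  assumes "lattice v (*s) K"
  shows "integral_submodule K \<longleftrightarrow> norm_ideal v B K \<subseteq> ring_of_integers v"
  using assms integer_submodule_integer_span
  by (auto simp: integral_submodule_def lattice_def norm_ideal_integral_iff)

lemma linear_preserves_B:
  assumes f: "Vector_Spaces.linear (*s) (*s) f" and "subspace W" "\<forall>x\<in>W. Q (f x) = Q x"
    and "x \<in> W" "y \<in> W"
  shows "B (f x) (f y) = B x y"
proof -
  interpret f: Vector_Spaces.linear "(*s)" "(*s)" f by fact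
  have "2 * B (f x) (f y) = 2 * B x y"
    using assms subspace_add by (simp add: polarization flip: f.add)
  then show ?thesis by simp
qed

definition isometry_on :: "'v set \<Rightarrow> ('v \<Rightarrow> 'v) \<Rightarrow> bool" where
  "isometry_on W g \<longleftrightarrow>
     Vector_Spaces.linear (*s) (*s) g \<and> g ` W \<subseteq> W \<and> (\<forall>x\<in>W. Q (g x) = Q x)"

lemma linear_id: "Vector_Spaces.linear (*s) (*s) (\<lambda>x. x)"
  using vector_space_axioms by (simp add: Vector_Spaces.linear_iff)

lemma isometry_on_id: "isometry_on W (\<lambda>x. x)"
  by (simp add: isometry_on_def linear_id)

lemma isometry_on_compose: "isometry_on W g \<Longrightarrow> isometry_on W h \<Longrightarrow> isometry_on W (h \<circ> g)"
  by (auto simp: isometry_on_def image_subset_iff intro: Vector_Spaces.linear_compose)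

section \<open>Maximal lattices represent integral submodules\<close>

definition hyperbolic_pair :: "'v \<Rightarrow> 'v \<Rightarrow> bool" where
  "hyperbolic_pair e f \<longleftrightarrow> Q e = 0 \<and> Q f = 0 \<and> B e f = 1"

definition hyperbolic_proj :: "'v \<Rightarrow> 'v \<Rightarrow> 'v \<Rightarrow> 'v" where
  "hyperbolic_proj e f w = w - B w f *s e - B w e *s f"

lemma hyperbolic_pairD:
  assumes "hyperbolic_pair e f"
  shows "Q e = 0" "Q f = 0" "B e f = 1" "B f e = 1"
  using assms B_commute by (simp_all add: hyperbolic_pair_def)

lemma hyperbolic_proj_perp: "hyperbolic_pair e f \<Longrightarrow> hyperbolic_proj e f w \<in> perp {e, f}"
  by (simp add: hyperbolic_proj_def B_simps hyperbolic_pairD)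

lemma Q_hyperbolic_proj:
  assumes "hyperbolic_pair e f"
  shows "Q w = 2 * (B w e * B w f) + Q (hyperbolic_proj e f w)"
  using hyperbolic_pairD[OF assms] B_commute[of e w] B_commute[of f w]
  by (simp add: hyperbolic_proj_def B_simps)

lemma B_hyperbolic_proj: "w \<in> perp {e, f} \<Longrightarrow> B w (hyperbolic_proj e f x) = B w x"
  by (simp add: hyperbolic_proj_def B_simps)

lemma linear_hyperbolic_proj: "Vector_Spaces.linear (*s) (*s) (hyperbolic_proj e f)"
  using vector_space_axioms
  by (simp add: Vector_Spaces.linear_iff hyperbolic_proj_def B_simps algebra_simps)

lemma hyperbolic_proj_mem:
  assumes "integer_submodule K" "e \<in> K" "f \<in> K" "0 \<le>\<^sub>v B w e" "0 \<le>\<^sub>v B w f" "w \<in> K"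
  shows "hyperbolic_proj e f w \<in> K"
  unfolding hyperbolic_proj_def using assms by (intro integer_submodule_diff integer_submodule_scale)

lemma hyperbolic_proj_mem_subspace:
  assumes "subspace W" "e \<in> W" "f \<in> W" "w \<in> W"
  shows "hyperbolic_proj e f w \<in> W"
  unfolding hyperbolic_proj_def using assms by (intro subspace_diff subspace_scale)

lemma hyperbolic_pair_exists:
  assumes xz: "B x z = 1" and x: "0 \<le>\<^sub>v Q x" and z: "1 \<le>\<^sub>v Q z"
  obtains e f where "hyperbolic_pair e f" "{e, f} \<subseteq> integer_span v (*s) {x, z}"
    "perp {e, f} = perp {x, z}"
proof -
  define c where "c = Q z"
  obtain t where t: "0 \<le>\<^sub>v t" "Q x + 2 * t + t * t * c = 0"
    using integral_root_quadratic[OF x z] by (auto simp: c_def)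
  define u where "u = 1 + t * c"
  have u: "0 =\<^sub>v u"
    using val_eq_add[OF val_eq_0_one, of "t * c"] val_ge_mult_left[OF t(1) z] by (simp add: u_def c_def)
  then have u_nonzero: "u \<noteq> 0" by (rule val_eq_nonzero)
  define e f where "e = x + t *s z" and "f = (1 / u) *s (z - (c / (2 * u)) *s e)"
  have Qe: "Q e = 0"
    using t(2) xz by (simp add: e_def c_def B_simps B_commute[of z x] algebra_simps)
  have Bez: "B e z = u" "B z e = u"
    using xz by (simp_all add: e_def u_def c_def B_simps B_commute[of z x])
  let ?L = "integer_span v (*s) {x, z}"
  have L: "integer_submodule ?L" "x \<in> ?L" "z \<in> ?L"
    using integer_submodule_integer_span integer_span_superset[of "{x, z}"] by auto
  have "0 \<le>\<^sub>v c" using z val_ge_mono unfolding c_def by (metis zero_le_one)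
  then have coeffs: "0 \<le>\<^sub>v 1 / u" "0 \<le>\<^sub>v c / (2 * u)"
    using u by (auto intro!: val_ge_divide_unit val_eq_mult_unit val_eq_0_two)
  show thesis
  proof (rule that)
    show "hyperbolic_pair e f"
      using u_nonzero by (simp add: hyperbolic_pair_def f_def B_simps Bez Qe field_simps flip: c_def)
    have "e \<in> ?L" unfolding e_def using L t(1) by (intro integer_submodule_add integer_submodule_scale)
    moreover from this have "f \<in> ?L"
      unfolding f_def using L coeffs by (intro integer_submodule_diff integer_submodule_scale)
    ultimately show "{e, f} \<subseteq> ?L" by simp
    show "perp {e, f} = perp {x, z}"
      using u_nonzero by (auto simp: f_def e_def B_simps)
  qed
qed

text \<open>Maximality in \<open>W\<close> is expressed through one-generator extensions \<open>M + \<O> x\<close>.\<close>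

definition maximal_submodule :: "'v set \<Rightarrow> 'v set \<Rightarrow> bool" where
  "maximal_submodule W M \<longleftrightarrow> integral_submodule M \<and> M \<subseteq> W \<and>
     (\<forall>x\<in>W. 0 \<le>\<^sub>v Q x \<longrightarrow> (\<forall>m\<in>M. 0 \<le>\<^sub>v B x m) \<longrightarrow> x \<in> M)"

lemma maximal_submodule_mem:
  "maximal_submodule W M \<Longrightarrow> x \<in> W \<Longrightarrow> 0 \<le>\<^sub>v Q x \<Longrightarrow> (\<And>m. m \<in> M \<Longrightarrow> 0 \<le>\<^sub>v B x m) \<Longrightarrow> x \<in> M"
  by (simp add: maximal_submodule_def)

lemma least_pairing_exists:
  assumes bounded: "\<And>n m. n \<in> N \<Longrightarrow> m \<in> M \<Longrightarrow> j \<le>\<^sub>v B n m"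
    and nonintegral: "n\<^sub>0 \<in> N" "m\<^sub>0 \<in> M" "\<not> 0 \<le>\<^sub>v B n\<^sub>0 m\<^sub>0"
  obtains x y \<beta> where "x \<in> N" "y \<in> M" "1 \<le>\<^sub>v \<beta>" "\<beta> * B x y = 1"
    "\<And>n m. n \<in> N \<Longrightarrow> m \<in> M \<Longrightarrow> 0 \<le>\<^sub>v \<beta> * B n m"
proof -
  let ?A = "{B n m |n m. n \<in> N \<and> m \<in> M}"
  have "B n\<^sub>0 m\<^sub>0 \<in> ?A" "B n\<^sub>0 m\<^sub>0 \<noteq> 0" using nonintegral by auto
  then obtain b where "b \<in> ?A" "b \<noteq> 0" "\<And>a. a \<in> ?A \<Longrightarrow> v b \<le>\<^sub>v a"
    using val_attains_min[of ?A j] bounded by blast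
  then obtain x y where xy: "x \<in> N" "y \<in> M" "B x y \<noteq> 0"
    and least: "\<And>n m. n \<in> N \<Longrightarrow> m \<in> M \<Longrightarrow> v (B x y) \<le>\<^sub>v B n m" by blast
  have "v (B x y) < 0" using least[OF nonintegral(1,2)] nonintegral(3) by (auto simp: val_ge_def)
  then have \<beta>: "1 \<le>\<^sub>v inverse (B x y)" "- v (B x y) \<le>\<^sub>v inverse (B x y)"
    using xy(3) by (simp_all add: val_ge_def val_inverse)
  then have "0 \<le>\<^sub>v inverse (B x y) * B n m" if "n \<in> N" "m \<in> M" for n m
    using val_ge_mult[OF \<beta>(2) least[OF that]] by simp
  with xy \<beta>(1) show thesis using that by simp
qed

lemma hyperbolic_pairs_of_least_pairing:
  assumes W: "subspace W" and max: "maximal_submodule W M"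
    and N: "integral_submodule N" "N \<subseteq> W" and x: "x \<in> N" and y: "y \<in> M"
    and \<beta>: "1 \<le>\<^sub>v \<beta>" "\<beta> * B x y = 1"
    and dual: "\<And>n m. n \<in> N \<Longrightarrow> m \<in> M \<Longrightarrow> 0 \<le>\<^sub>v \<beta> * B n m"
  obtains e f e' f' where "hyperbolic_pair e f" "hyperbolic_pair e' f'" "perp {e, f} = perp {e', f'}"
    "{e, f} \<subseteq> W" "{e', f'} \<subseteq> M" "\<And>n. n \<in> N \<Longrightarrow> 0 \<le>\<^sub>v B n e \<and> 0 \<le>\<^sub>v B n f"
proof -
  have M: "integral_submodule M" "M \<subseteq> W" using max by (simp_all add: maximal_submodule_def)
  define z z' where "z = \<beta> *s y" and "z' = \<beta> *s x"
  have zM: "z \<in> M" and z'N: "z' \<in> N"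
    using x y M N val_ge_mono[OF \<beta>(1), of 0]
    by (simp_all add: z_def z'_def integral_submodule_def integer_submodule_scale)
  have z'M: "z' \<in> M"
  proof (rule maximal_submodule_mem[OF max])
    show "z' \<in> W" "0 \<le>\<^sub>v Q z'" using z'N N integral_submodule_Q by auto
    show "0 \<le>\<^sub>v B z' m" if "m \<in> M" for m using dual[OF x that] by (simp add: z'_def B_simps)
  qed
  have "1 \<le>\<^sub>v Q z" "1 \<le>\<^sub>v Q z'"
    using val_ge_mult_right[OF \<beta>(1) integral_submodule_B[OF M(1) y zM]]
      val_ge_mult_right[OF \<beta>(1) integral_submodule_B[OF N(1) x z'N]]
    by (simp_all add: z_def z'_def B_simps)
  moreover have "B x z = 1" "B y z' = 1"
    using \<beta>(2) by (simp_all add: z_def z'_def B_simps B_commute[of y x])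
  ultimately obtain e f e' f' where
    ef: "hyperbolic_pair e f" "{e, f} \<subseteq> integer_span v (*s) {x, z}" "perp {e, f} = perp {x, z}" and
    ef': "hyperbolic_pair e' f'" "{e', f'} \<subseteq> integer_span v (*s) {y, z'}" "perp {e', f'} = perp {y, z'}"
    using hyperbolic_pair_exists[of x z] hyperbolic_pair_exists[of y z'] integral_submodule_Q M N x y
    by metis
  have "integer_span v (*s) {x, z} \<subseteq> W"
    using W x N zM M by (intro integer_span_minimal subspace_imp_integer_submodule) auto
  moreover have "integer_span v (*s) {y, z'} \<subseteq> M"
    using M y z'M by (intro integer_span_minimal integral_submodule_imp_integer) auto
  moreover have "\<beta> \<noteq> 0" using \<beta>(2) by auto
  then have "perp {x, z} = perp {y, z'}"
    by (auto simp: z_def z'_def B_simps)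
  moreover have "0 \<le>\<^sub>v B n w" if "n \<in> N" "w \<in> integer_span v (*s) {x, z}" for n w
    using dual[OF that(1) y] integral_submodule_B[OF N(1) that(1) x] integer_span_superset[of "{n}"]
    by (intro integer_span_B[OF _ _ that(2), of "{n}"]) (auto simp: z_def B_simps)
  ultimately show thesis using that[OF ef(1) ef'(1)] ef ef' by auto
qed

lemma maximal_submodule_perp:
  assumes max: "maximal_submodule W M" and W: "subspace W"
    and ef: "hyperbolic_pair e f" "{e, f} \<subseteq> M"
  shows "maximal_submodule (W \<inter> perp {e, f}) (M \<inter> perp {e, f})"
proof -
  have M: "integral_submodule M" "M \<subseteq> W" using max by (simp_all add: maximal_submodule_def)
  have "x \<in> M" if x: "x \<in> W" "x \<in> perp {e, f}" "0 \<le>\<^sub>v Q x"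
    and dual: "\<And>m. m \<in> M \<inter> perp {e, f} \<Longrightarrow> 0 \<le>\<^sub>v B x m" for x
  proof (rule maximal_submodule_mem[OF max x(1,3)])
    fix m assume m: "m \<in> M"
    then have "hyperbolic_proj e f m \<in> M \<inter> perp {e, f}"
      using M ef integral_submodule_B[OF M(1) m] hyperbolic_proj_perp
      by (auto intro: hyperbolic_proj_mem integral_submodule_imp_integer)
    then show "0 \<le>\<^sub>v B x m" using dual B_hyperbolic_proj[OF x(2)] by metis
  qed
  moreover have "integral_submodule (M \<inter> perp {e, f})"
    using M(1) subspace_imp_integer_submodule[OF subspace_perp]
    by (simp add: integral_submodule_def integer_submodule_Int)
  ultimately show ?thesis using M(2) by (auto simp: maximal_submodule_def)
qed

lemma integral_submodule_hyperbolic_proj: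
  assumes N: "integral_submodule N" and ef: "hyperbolic_pair e f"
    and dual: "\<And>n. n \<in> N \<Longrightarrow> 0 \<le>\<^sub>v B n e \<and> 0 \<le>\<^sub>v B n f"
  shows "integral_submodule (hyperbolic_proj e f ` N)"
proof -
  have "0 \<le>\<^sub>v Q (hyperbolic_proj e f n)" if "n \<in> N" for n
  proof -
    have "Q (hyperbolic_proj e f n) = Q n - 2 * (B n e * B n f)"
      using Q_hyperbolic_proj[OF ef, of n] by simp
    then show ?thesis
      using dual[OF that] integral_submodule_Q[OF N that] val_eq_imp_val_ge[OF val_eq_0_two]
      by (auto intro!: val_ge_diff val_ge_mult_left)
  qed
  moreover have "integer_submodule (hyperbolic_proj e f ` N)"
    using linear_hyperbolic_proj valued_vector_space_axioms integral_submodule_imp_integer[OF N]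
    by (rule integer_submodule_linear_image)
  ultimately show ?thesis by (auto simp: integral_submodule_def)
qed

definition hyperbolic_extension :: "'v \<Rightarrow> 'v \<Rightarrow> 'v \<Rightarrow> 'v \<Rightarrow> ('v \<Rightarrow> 'v) \<Rightarrow> 'v \<Rightarrow> 'v" where
  "hyperbolic_extension e f e' f' g w = B w f *s e' + B w e *s f' + g (hyperbolic_proj e f w)"

lemma isometry_on_hyperbolic_extension:
  assumes W: "subspace W" "{e, f} \<subseteq> W" "{e', f'} \<subseteq> W"
    and ef: "hyperbolic_pair e f" and ef': "hyperbolic_pair e' f'"
    and perp: "perp {e, f} = perp {e', f'}"
    and g: "isometry_on (W \<inter> perp {e, f}) g"
  shows "isometry_on W (hyperbolic_extension e f e' f' g)"
proof -
  let ?h = "hyperbolic_extension e f e' f' g"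
  interpret g: Vector_Spaces.linear "(*s)" "(*s)" g using g by (simp add: isometry_on_def)
  interpret p: Vector_Spaces.linear "(*s)" "(*s)" "hyperbolic_proj e f" by (rule linear_hyperbolic_proj)
  have "Vector_Spaces.linear (*s) (*s) ?h"
    using vector_space_axioms
    by (simp add: Vector_Spaces.linear_iff hyperbolic_extension_def g.add g.scale p.add p.scale
        B_simps algebra_simps)
  moreover have "?h w \<in> W \<and> Q (?h w) = Q w" if w: "w \<in> W" for w
  proof -
    let ?p = "hyperbolic_proj e f w"
    have "?p \<in> W \<inter> perp {e, f}"
      using w W ef hyperbolic_proj_perp by (auto intro: hyperbolic_proj_mem_subspace)
    then have "g ?p \<in> W \<inter> perp {e', f'}" and Q_gp: "Q (g ?p) = Q ?p"
      using g perp unfolding isometry_on_def by blast+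
    then have gp: "g ?p \<in> W" "g ?p \<in> perp {e', f'}" by simp_all
    then have "?h w \<in> W"
      unfolding hyperbolic_extension_def using W by (auto intro!: subspace_add subspace_scale)
    moreover have "B e' (g ?p) = 0" "B f' (g ?p) = 0" using gp(2) B_commute by auto
    then have "Q (?h w) = 2 * (B w e * B w f) + Q (g ?p)"
      using hyperbolic_pairD[OF ef'] gp(2) by (simp add: hyperbolic_extension_def B_simps)
    ultimately show ?thesis using Q_hyperbolic_proj[OF ef, of w] Q_gp by simp
  qed
  ultimately show ?thesis by (auto simp: isometry_on_def)
qed

lemma isometry_into_extend_hyperbolic:
  assumes W: "subspace W" and M: "integer_submodule M" "M \<subseteq> W"
    and ef: "hyperbolic_pair e f" "{e, f} \<subseteq> W" and ef': "hyperbolic_pair e' f'" "{e', f'} \<subseteq> M"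
    and perp: "perp {e, f} = perp {e', f'}" and dual: "\<And>n. n \<in> N \<Longrightarrow> 0 \<le>\<^sub>v B n e \<and> 0 \<le>\<^sub>v B n f"
    and g: "isometry_on (W \<inter> perp {e, f}) g" "g ` hyperbolic_proj e f ` N \<subseteq> M"
  shows "\<exists>h. isometry_on W h \<and> h ` N \<subseteq> M"
proof (intro exI conjI)
  let ?h = "hyperbolic_extension e f e' f' g"
  show "isometry_on W ?h"
    using ef'(2) M(2)
    by (intro isometry_on_hyperbolic_extension[OF W ef(2) _ ef(1) ef'(1) perp g(1)]) auto
  have "?h n \<in> M" if "n \<in> N" for n
    unfolding hyperbolic_extension_def using that g(2) ef'(2) dual[OF that] M(1)
    by (intro integer_submodule_add integer_submodule_scale) auto
  then show "?h ` N \<subseteq> M" by blast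
qed

theorem maximal_submodule_represents:
  assumes "finite S" "W \<subseteq> span S" "subspace W" "maximal_submodule W M"
    and "integral_submodule N" "N \<subseteq> W" "\<And>x y. x \<in> N \<Longrightarrow> y \<in> M \<Longrightarrow> j \<le>\<^sub>v B x y"
  shows "\<exists>g. isometry_on W g \<and> g ` N \<subseteq> M"
  using assms(2-)
proof (induction "dim W" arbitrary: W M N rule: less_induct)
  case less
  note WS = \<open>W \<subseteq> span S\<close> and W = \<open>subspace W\<close> and max = \<open>maximal_submodule W M\<close>
    and N = \<open>integral_submodule N\<close> and NW = \<open>N \<subseteq> W\<close> and bounded = less.prems(6)
  show ?case
  proof (cases "\<forall>x\<in>N. \<forall>y\<in>M. 0 \<le>\<^sub>v B x y")
    case True
    then have "N \<subseteq> M" using maximal_submodule_mem[OF max] NW integral_submodule_Q[OF N] by blast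
    then show ?thesis using isometry_on_id by (intro exI[of _ "\<lambda>x. x"]) auto
  next
    case False
    then obtain x y \<beta> where xy: "x \<in> N" "y \<in> M" "1 \<le>\<^sub>v \<beta>" "\<beta> * B x y = 1"
      "\<And>n m. n \<in> N \<Longrightarrow> m \<in> M \<Longrightarrow> 0 \<le>\<^sub>v \<beta> * B n m"
      using least_pairing_exists[of N M j] bounded by metis
    obtain e f e' f' where
      ef: "hyperbolic_pair e f" "{e, f} \<subseteq> W" and ef': "hyperbolic_pair e' f'" "{e', f'} \<subseteq> M"
      and perp: "perp {e, f} = perp {e', f'}" and dual: "\<And>n. n \<in> N \<Longrightarrow> 0 \<le>\<^sub>v B n e \<and> 0 \<le>\<^sub>v B n f"
      using hyperbolic_pairs_of_least_pairing[OF W max N NW xy] by metis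
    let ?W = "W \<inter> perp {e, f}" and ?M = "M \<inter> perp {e, f}" and ?p = "hyperbolic_proj e f"
    have "e \<notin> perp {e, f}" using hyperbolic_pairD[OF ef(1)] by simp
    then have "dim ?W < dim W"
      using dim_psubset[OF assms(1) WS] subspace_inter[OF W subspace_perp] ef(2) by blast
    moreover have "maximal_submodule ?W ?M"
      using maximal_submodule_perp[OF max W ef'] by (simp add: perp)
    moreover have "?p ` N \<subseteq> ?W"
      using NW ef W hyperbolic_proj_perp[OF ef(1)]
      by (auto simp del: mem_perp_insert intro: hyperbolic_proj_mem_subspace)
    moreover have "j \<le>\<^sub>v B a m" if "a \<in> ?p ` N" "m \<in> ?M" for a m
      using that bounded B_hyperbolic_proj[of m e f] B_commute by auto
    ultimately obtain g where "isometry_on ?W g" "g ` ?p ` N \<subseteq> M"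
      using less.hyps[of ?W ?M "?p ` N"] WS subspace_inter[OF W subspace_perp]
        integral_submodule_hyperbolic_proj[OF N ef(1) dual] by (metis inf.coboundedI1 le_inf_iff)
    moreover have "integer_submodule M" "M \<subseteq> W"
      using max by (auto simp: maximal_submodule_def integral_submodule_def)
    ultimately show ?thesis by (intro isometry_into_extend_hyperbolic[OF W _ _ ef ef' perp dual])
  qed
qed

lemma maximal_lattice_imp_maximal_submodule:
  assumes M: "lattice v (*s) M" "maximal_lattice v (*s) B M"
  shows "maximal_submodule (span M) M"
proof -
  obtain S where S: "finite S" "M = integer_span v (*s) S" using M by (auto simp: lattice_def)
  have integral: "integral_submodule M"
    using M by (simp add: integral_submodule_iff_lattice maximal_lattice_def)
  have "x \<in> M" if x: "x \<in> span M" "0 \<le>\<^sub>v Q x" "\<forall>m\<in>M. 0 \<le>\<^sub>v B x m" for x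
  proof -
    let ?K = "integer_span v (*s) (insert x S)"
    have K: "lattice v (*s) ?K" using S by (auto simp: lattice_def)
    have "S \<subseteq> M" using S integer_span_superset by simp
    then have "integral_submodule ?K"
      using integral_submodule_B[OF integral] x B_commute
      by (intro integral_submodule_integer_span) (auto simp: subset_iff)
    moreover have "M \<subseteq> ?K"
      unfolding S(2) using integer_span_superset[of "insert x S"]
      by (intro integer_span_minimal integer_submodule_integer_span) auto
    moreover have "span ?K = span M"
      using x by (simp add: S(2) span_integer_span span_redundant)
    ultimately have "?K = M"
      using M(2) K by (auto simp: maximal_lattice_def integral_submodule_iff_lattice)
    then show ?thesis using integer_span_superset[of "insert x S"] by auto
  qed
  then show ?thesis using integral span_superset by (auto simp: maximal_submodule_def)
qed

theorem maximal_lattice_imp_n_ADC: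
  assumes M: "lattice v (*s) M" "maximal_lattice v (*s) B M"
  shows "n_ADC v n (*s) B M"
  unfolding n_ADC_def
proof (intro allI impI)
  fix C N
  assume N: "integral_lattice v seq_scale C N \<and> lattice_rank seq_scale N = n \<and>
    space_represents (*s) B (span M) seq_scale C (module.span seq_scale N)"
  interpret seq: valued_vector_space v "seq_scale :: 'f \<Rightarrow> _"
    by (intro valued_vector_space.intro nonarch_local_field_axioms vector_space_seq_scale)
  obtain \<sigma> where \<sigma>: "Vector_Spaces.linear seq_scale (*s) \<sigma>" "\<sigma> ` seq.span N \<subseteq> span M"
    "\<forall>x\<in>seq.span N. Q (\<sigma> x) = C x x"
    using N by (auto simp: space_represents_def)
  obtain S where S: "finite S" "M = integer_span v (*s) S" using M by (auto simp: lattice_def)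
  obtain T where T: "finite T" "N = integer_span v seq_scale T"
    using N by (auto simp: integral_lattice_def lattice_def)
  have \<sigma>N: "\<sigma> ` N = integer_span v (*s) (\<sigma> ` T)"
    unfolding T(2) using \<sigma>(1) seq.valued_vector_space_axioms by (rule integer_span_linear_image)
  have "0 \<le>\<^sub>v Q (\<sigma> x)" if "x \<in> N" for x
    using N \<sigma>(3) seq.span_base[OF that] that by (simp add: integral_lattice_def norm_ideal_integral_iff)
  then have "integral_submodule (\<sigma> ` N)"
    using integer_submodule_integer_span[of "\<sigma> ` T"] unfolding \<sigma>N[symmetric]
    by (auto simp: integral_submodule_def)
  moreover obtain j where "\<forall>b\<in>(\<lambda>(t, s). B t s) ` (\<sigma> ` T \<times> S). j \<le>\<^sub>v b"
    using finite_imp_val_bounded[of "(\<lambda>(t, s). B t s) ` (\<sigma> ` T \<times> S)"] S(1) T(1) by blast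
  then have "j \<le>\<^sub>v B x y" if "x \<in> \<sigma> ` N" "y \<in> M" for x y
    using that integer_span_B[of "\<sigma> ` T" S j x y] by (auto simp: \<sigma>N S(2))
  moreover have "\<sigma> ` N \<subseteq> span M" using \<sigma>(2) seq.span_superset[of N] by blast
  moreover have "span M \<subseteq> span S" by (simp add: S(2) span_integer_span)
  ultimately obtain g where g: "isometry_on (span M) g" "g ` \<sigma> ` N \<subseteq> M"
    using maximal_lattice_imp_maximal_submodule[OF M]
      maximal_submodule_represents[OF S(1) _ subspace_span]
    by meson
  have "Vector_Spaces.linear seq_scale (*s) (g \<circ> \<sigma>)"
    using Vector_Spaces.linear_compose \<sigma>(1) g(1) by (auto simp: isometry_on_def)
  then show "lattice_represents (*s) B M seq_scale C N"
    unfolding lattice_represents_def using g \<sigma>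
    by (intro exI[of _ "g \<circ> \<sigma>"]) (auto simp: isometry_on_def image_subset_iff)
qed

end

section \<open>Orthogonal frames\<close>

context quadratic_ambient
begin

definition orthogonal_frame :: "'v set \<Rightarrow> bool" where
  "orthogonal_frame X \<longleftrightarrow>
     finite X \<and> (\<forall>x\<in>X. Q x \<noteq> 0) \<and> (\<forall>x\<in>X. \<forall>y\<in>X. x \<noteq> y \<longrightarrow> B x y = 0)"

definition unit_frame :: "'v set \<Rightarrow> bool" where
  "unit_frame X \<longleftrightarrow> orthogonal_frame X \<and> (\<forall>x\<in>X. 0 =\<^sub>v Q x)"

definition proj :: "'v set \<Rightarrow> 'v \<Rightarrow> 'v" where
  "proj X z = z - (\<Sum>x\<in>X. (B z x / Q x) *s x)"

lemma orthogonal_frameD: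
  assumes "orthogonal_frame X"
  shows "finite X" "x \<in> X \<Longrightarrow> Q x \<noteq> 0" "x \<in> X \<Longrightarrow> y \<in> X \<Longrightarrow> x \<noteq> y \<Longrightarrow> B x y = 0"
  using assms by (auto simp: orthogonal_frame_def)

lemma unit_frameD:
  assumes "unit_frame X"
  shows "orthogonal_frame X" "finite X" "x \<in> X \<Longrightarrow> 0 =\<^sub>v Q x"
  using assms by (auto simp: unit_frame_def orthogonal_frame_def)

lemma unit_frame_empty: "unit_frame {}"
  by (simp add: unit_frame_def orthogonal_frame_def)

lemma unit_frame_subset: "unit_frame X \<Longrightarrow> Y \<subseteq> X \<Longrightarrow> unit_frame Y"
  by (auto simp: unit_frame_def orthogonal_frame_def finite_subset subset_iff)

lemma orthogonal_frame_insert: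
  assumes "orthogonal_frame X" "z \<in> perp X" "Q z \<noteq> 0"
  shows "orthogonal_frame (insert z X)" "z \<notin> X"
  using assms B_commute by (auto simp: orthogonal_frame_def perp_def)

lemma unit_frame_insert:
  assumes "unit_frame X" "z \<in> perp X" "0 =\<^sub>v Q z"
  shows "unit_frame (insert z X)" "z \<notin> X"
  using assms orthogonal_frame_insert[of X z] val_eq_nonzero by (auto simp: unit_frame_def)

lemma B_frame_sum:
  assumes "orthogonal_frame X" "x \<in> X" shows "B (\<Sum>y\<in>X. c y *s y) x = c x * Q x"
proof -
  have "B (\<Sum>y\<in>X. c y *s y) x = (\<Sum>y\<in>X. if y = x then c x * Q x else 0)"
    unfolding B_sum_left using assms by (intro sum.cong) (auto simp: B_simps orthogonal_frame_def)
  then show ?thesis using assms by (simp add: orthogonal_frame_def)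
qed

lemma proj_mem_perp: "orthogonal_frame X \<Longrightarrow> proj X z \<in> perp X"
  by (auto simp: perp_def proj_def B_simps B_frame_sum orthogonal_frameD(2))

lemma B_proj:
  assumes "w \<in> perp X" shows "B w (proj X z) = B w z"
proof -
  have "B (\<Sum>x\<in>X. (B z x / Q x) *s x) w = 0"
    unfolding B_sum_left using assms B_commute[of _ w]
    by (intro sum.neutral) (auto simp: perp_def B_simps)
  then show ?thesis by (simp add: proj_def B_simps B_commute[of w "sum _ _"])
qed

lemma proj_mem_subspace: "subspace W \<Longrightarrow> X \<subseteq> W \<Longrightarrow> z \<in> W \<Longrightarrow> proj X z \<in> W"
  unfolding proj_def by (intro subspace_diff subspace_sum subspace_scale) auto

lemma diff_proj_mem:
  assumes "integer_submodule M" "X \<subseteq> M" "\<And>x. x \<in> X \<Longrightarrow> 0 \<le>\<^sub>v B z x / Q x"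
  shows "z - proj X z \<in> M"
  using assms by (auto simp: proj_def intro!: integer_submodule_sum integer_submodule_scale)

lemma diff_proj_mem_span: "z - proj X z \<in> span X"
  by (simp add: proj_def span_sum span_scale span_base)

lemma unit_frame_coefficient:
  assumes "integral_submodule K" "unit_frame X" "X \<subseteq> K" "z \<in> K" "x \<in> X"
  shows "0 \<le>\<^sub>v B z x / Q x"
  using assms integral_submodule_B[of K z x] unit_frameD(3)[of X x] by (auto intro: val_ge_divide_unit)

lemma proj_mem_integral_submodule:
  assumes K: "integral_submodule K" and X: "unit_frame X" "X \<subseteq> K" and z: "z \<in> K"
  shows "proj X z \<in> K"
proof -
  note K_integer = integral_submodule_imp_integer[OF K]
  have "z - proj X z \<in> K"
    using K_integer X(2) unit_frame_coefficient[OF K X z] by (rule diff_proj_mem)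
  with K_integer z have "z - (z - proj X z) \<in> K" by (rule integer_submodule_diff)
  then show ?thesis by simp
qed

lemma eq_zero_if_span_perp:
  assumes X: "orthogonal_frame X" and x: "x \<in> span X" "x \<in> perp X" shows "x = 0"
proof -
  obtain c where c: "x = (\<Sum>y\<in>X. c y *s y)"
    using x(1) span_finite[OF orthogonal_frameD(1)[OF X]] by auto
  have "c y = 0" if "y \<in> X" for y
    using B_frame_sum[OF X that, of c] X x(2) that by (auto simp: c perp_def orthogonal_frame_def)
  then show ?thesis by (simp add: c)
qed

lemma orthogonal_frame_independent:
  assumes "orthogonal_frame X" shows "independent X"
  using orthogonal_frameD(1)[OF assms] assms
proof (induction X rule: finite_induct)
  case empty
  then show ?case by (simp add: independent_empty)
next
  case (insert x X)
  have X: "orthogonal_frame X" "x \<in> perp X" "x \<noteq> 0"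
    using insert by (auto simp: orthogonal_frame_def perp_def)
  then have "x \<notin> span X" using eq_zero_if_span_perp by blast
  then show ?case using insert X by (intro independent_insertI)
qed

lemma split_off_vector:
  assumes "integer_submodule K" "b \<in> K" "y \<in> K" "0 \<le>\<^sub>v \<beta>" "B y b = \<beta> * Q b"
  shows "y - \<beta> *s b \<in> K" "B (y - \<beta> *s b) b = 0" "Q (y - \<beta> *s b) = Q y - \<beta> * \<beta> * Q b"
  using assms B_commute[of b y]
  by (simp_all add: B_simps integer_submodule_diff integer_submodule_scale)

lemma unit_coefficient_exists:
  assumes "integral_submodule K" "b \<in> K" "y \<in> K" "0 =\<^sub>v Q b"
  obtains \<beta> where "0 \<le>\<^sub>v \<beta>" "B y b = \<beta> * Q b"
  using that[of "B y b / Q b"] val_ge_divide_unit[OF integral_submodule_B[OF assms(1,3,2)] assms(4)]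
    val_eq_nonzero[OF assms(4)] by simp

section \<open>Binary and ternary subspaces\<close>

lemma orthogonal_pair_nonsquare_norm:
  assumes W: "subspace W" "b \<in> W" "a \<in> W" "B b a = 0" and val: "k =\<^sub>v Q b" "k =\<^sub>v Q a"
    and \<Delta>: "0 =\<^sub>v \<Delta>"
  obtains y where "y \<in> W" "k + 1 \<le>\<^sub>v \<Delta> * Q b - Q y" "k =\<^sub>v Q y"
proof -
  have \<Delta>b: "k =\<^sub>v \<Delta> * Q b" using \<Delta> val(1) by (rule val_eq_mult_unit)
  then have "k \<le>\<^sub>v \<Delta> * Q b" by (simp add: val_eq_iff)
  then obtain s t where st: "k + 1 \<le>\<^sub>v Q b * (s * s) + Q a * (t * t) - \<Delta> * Q b"
    using binary_form_represents[OF val] by metis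
  define y where "y = s *s b + t *s a"
  have "Q y = Q b * (s * s) + Q a * (t * t)"
    using W(4) B_commute[of a b] by (simp add: y_def B_simps algebra_simps)
  then have "k + 1 \<le>\<^sub>v \<Delta> * Q b - Q y" using st val_ge_diff_commute by simp
  moreover have "y \<in> W" unfolding y_def using W by (intro subspace_add subspace_scale)
  ultimately show thesis using that val_eq_cong[OF \<Delta>b] by blast
qed

text \<open>
  For \<open>Q m \<equiv> \<Delta> Q b\<close> with a non-square unit \<open>\<Delta>\<close>, the component of \<open>m\<close> orthogonal to \<open>b\<close> has norm
  congruent to \<open>(\<Delta> - \<beta>\<^sup>2) Q b\<close>.
\<close>

lemma split_off_vector_val_eq:
  assumes K: "integer_submodule K" "b \<in> K" "m \<in> K" and \<beta>: "0 \<le>\<^sub>v \<beta>" "B m b = \<beta> * Q b"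
    and b: "k =\<^sub>v Q b" and \<Delta>: "0 =\<^sub>v \<Delta>" "\<not> residue_square \<Delta>" and m: "k + 1 \<le>\<^sub>v \<Delta> * Q b - Q m"
  shows "k =\<^sub>v Q (m - \<beta> *s b)"
proof (rule val_eq_cong)
  have "0 =\<^sub>v \<Delta> - \<beta> * \<beta>"
    using val_eq_0_nonsquare_diff[OF \<Delta>(2) _ \<beta>(1)] val_eq_imp_val_ge[OF \<Delta>(1)] by simp
  then show "k =\<^sub>v (\<Delta> - \<beta> * \<beta>) * Q b" using b by (rule val_eq_mult_unit)
  have "(\<Delta> - \<beta> * \<beta>) * Q b - Q (m - \<beta> *s b) = \<Delta> * Q b - Q m"
    using split_off_vector(3)[OF K \<beta>] by (simp add: algebra_simps)
  then show "k + 1 \<le>\<^sub>v (\<Delta> - \<beta> * \<beta>) * Q b - Q (m - \<beta> *s b)" using m by simp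
qed

lemma split_off_unit_pair:
  assumes M: "integral_submodule M" and b: "b \<in> M \<inter> perp X" "0 =\<^sub>v Q b"
    and w: "w \<in> M \<inter> perp (insert b X)" "0 =\<^sub>v Q w" and m: "m \<in> M \<inter> perp X"
  obtains \<beta> \<gamma> m' where "0 \<le>\<^sub>v \<beta>" "0 \<le>\<^sub>v \<gamma>" "m' \<in> M \<inter> perp (insert w (insert b X))"
    "Q m = Q b * (\<beta> * \<beta>) + Q w * (\<gamma> * \<gamma>) + Q m'"
proof -
  have K: "integer_submodule (M \<inter> perp Y)" for Y
    using integral_submodule_imp_integer[OF M] subspace_imp_integer_submodule[OF subspace_perp]
    by (rule integer_submodule_Int)
  obtain \<beta> where \<beta>: "0 \<le>\<^sub>v \<beta>" "B m b = \<beta> * Q b"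
    using unit_coefficient_exists[OF M _ _ b(2), of m] b m by blast
  note split_b = split_off_vector[OF K b(1) m \<beta>]
  define m\<^sub>1 where "m\<^sub>1 = m - \<beta> *s b"
  have m\<^sub>1: "m\<^sub>1 \<in> M \<inter> perp (insert b X)" using split_b(1,2) by (simp add: m\<^sub>1_def)
  obtain \<gamma> where \<gamma>: "0 \<le>\<^sub>v \<gamma>" "B m\<^sub>1 w = \<gamma> * Q w"
    using unit_coefficient_exists[OF M _ _ w(2), of m\<^sub>1] w m\<^sub>1 by blast
  note split_w = split_off_vector[OF K w(1) m\<^sub>1 \<gamma>]
  have "m\<^sub>1 - \<gamma> *s w \<in> M \<inter> perp (insert w (insert b X))" using split_w(1,2) by simp
  moreover have "Q m = Q b * (\<beta> * \<beta>) + Q w * (\<gamma> * \<gamma>) + Q (m\<^sub>1 - \<gamma> *s w)"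
    using split_b(3) split_w(3) by (simp add: m\<^sub>1_def algebra_simps)
  ultimately show thesis using that \<beta>(1) \<gamma>(1) by blast
qed

lemma orthogonal_pair_rotate:
  assumes M: "integer_submodule M" and b: "b \<in> M" "0 =\<^sub>v Q b" and w: "w \<in> M" "0 =\<^sub>v Q w"
    and bw: "B b w = 0" and c: "0 \<le>\<^sub>v c"
  obtains h h' where "h \<in> M" "h' \<in> M" "perp {b, w} \<subseteq> perp {h, h'}" "B h h' = 0"
    "1 \<le>\<^sub>v Q h - c" "Q h' = Q b * Q w * Q h"
proof -
  obtain x y where xy: "0 \<le>\<^sub>v x" "0 \<le>\<^sub>v y" "1 \<le>\<^sub>v Q b * (x * x) + Q w * (y * y) - c"
    by (rule unit_binary_form_represents[OF b(2) w(2) c])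
  define h where "h = x *s b + y *s w"
  define h' where "h' = (- (y * Q w)) *s b + (x * Q b) *s w"
  have wb: "B w b = 0" using bw B_commute by simp
  have Qh: "Q h = Q b * (x * x) + Q w * (y * y)"
    by (simp add: h_def B_simps bw wb algebra_simps)
  have norms: "0 \<le>\<^sub>v Q b" "0 \<le>\<^sub>v Q w" using b(2) w(2) by (auto intro: val_eq_imp_val_ge)
  show thesis
  proof (rule that)
    show "h \<in> M" unfolding h_def using M b w xy by (intro integer_submodule_add integer_submodule_scale)
    show "h' \<in> M"
      unfolding h'_def using M b w xy norms
      by (intro integer_submodule_add integer_submodule_scale) (auto intro: val_ge_mult_left)
    show "perp {b, w} \<subseteq> perp {h, h'}" by (auto simp: h_def h'_def B_simps)
    show "B h h' = 0" by (simp add: h_def h'_def B_simps bw wb algebra_simps)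
    show "1 \<le>\<^sub>v Q h - c" using xy(3) by (simp add: Qh)
    show "Q h' = Q b * Q w * Q h" by (simp add: Qh h'_def B_simps bw wb algebra_simps)
  qed
qed

text \<open>
  If \<open>- Q b Q w\<close> is a residue square, rotating the pair \<open>b, w\<close> to \<open>h, h'\<close> with \<open>Q h \<equiv> \<Delta> Q a\<close> for a
  non-square \<open>\<Delta>\<close> makes the pair \<open>h', a\<close> anisotropic.
\<close>

lemma unit_frame_anisotropic_pair:
  assumes M: "integer_submodule M" and Z: "unit_frame Z" "Z \<subseteq> M" "3 \<le> card Z"
  obtains Z' b w where "unit_frame Z'" "Z' \<subseteq> M" "card Z' = card Z" "b \<in> Z'" "w \<in> Z'" "b \<noteq> w"
    "\<not> residue_square (- (Q b * Q w))"
proof -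
  obtain T where "T \<subseteq> Z" "card T = 3" using obtain_subset_with_card_n[OF Z(3)] by metis
  then obtain a b w where abw: "{a, b, w} \<subseteq> Z" "a \<noteq> b" "b \<noteq> w" "a \<noteq> w"
    by (auto simp: card_3_iff)
  then have units: "0 =\<^sub>v Q a" "0 =\<^sub>v Q b" "0 =\<^sub>v Q w" using unit_frameD(3)[OF Z(1)] by auto
  show thesis
  proof (cases "residue_square (- (Q b * Q w))")
    case False
    then show thesis using that Z(1,2) abw by blast
  next
    case True
    obtain \<Delta> where \<Delta>: "0 =\<^sub>v \<Delta>" "\<not> residue_square \<Delta>" by (rule residue_nonsquare_exists)
    have unit: "0 =\<^sub>v \<Delta> * Q a" using \<Delta>(1) units(1) by (rule val_eq_mult_unit)
    obtain h h' where h: "h \<in> M" "h' \<in> M" "perp {b, w} \<subseteq> perp {h, h'}" "B h h' = 0"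
      "1 \<le>\<^sub>v Q h - \<Delta> * Q a" "Q h' = Q b * Q w * Q h"
      using orthogonal_pair_rotate[OF M _ units(2) _ units(3), of "\<Delta> * Q a"] abw Z
        orthogonal_frameD(3)[OF unit_frameD(1)[OF Z(1)], of b w] val_eq_imp_val_ge[OF unit] by auto
    have Qh: "0 =\<^sub>v Q h" using val_eq_cong[OF unit] h(5) val_ge_diff_commute by auto
    then have Qh': "0 =\<^sub>v Q h'" using units by (simp add: h(6) val_eq_mult_unit)
    define Y where "Y = Z - {b, w}"
    have Y: "unit_frame Y" "a \<in> Y" "Y \<subseteq> M" "card Z = card Y + 2"
      using unit_frame_subset[OF Z(1), of Y] abw Z unit_frameD(2)[OF Z(1)]
      by (auto simp: Y_def card_Diff_subset card_mono)
    have "Y \<subseteq> perp {b, w}"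
      using orthogonal_frameD(3)[OF unit_frameD(1)[OF Z(1)]] abw by (simp add: Y_def subset_iff)
    then have "h \<in> perp Y" "h' \<in> perp Y" using h(3) B_commute by (auto simp: perp_def)
    then have hY: "unit_frame (insert h Y)" "h \<notin> Y" and "h' \<in> perp (insert h Y)"
      using unit_frame_insert[OF Y(1) _ Qh] h(4) B_commute by auto
    then have h'Y: "unit_frame (insert h' (insert h Y))" "h' \<notin> insert h Y"
      using unit_frame_insert[OF hY(1) _ Qh'] by blast+
    have "\<not> residue_square (- (Q b * Q w) * (Q h * Q a))"
      using val_eq_mult_unit[OF units(2,3)] True units(1) Qh h(5) \<Delta>(2)
      by (intro residue_nonsquare_exchange) simp_all
    then have "\<not> residue_square (- (Q h' * Q a))" by (simp add: h(6) algebra_simps)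
    then show thesis
      using that[of "insert h' (insert h Y)" h' a] h hY h'Y Y unit_frameD(2)[OF Y(1)] by auto
  qed
qed

lemma subspace_prime_norm_exists:
  assumes W: "subspace W" "b \<in> W" "w \<in> W" "k \<in> W" and orth: "B b w = 0" "B b k = 0" "B w k = 0"
    and bw: "0 =\<^sub>v Q b" "0 =\<^sub>v Q w" and k: "0 =\<^sub>v Q k \<or> 1 =\<^sub>v Q k"
  obtains u where "u \<in> W" "1 =\<^sub>v Q u"
proof (cases "1 =\<^sub>v Q k")
  case True
  then show thesis using that W(4) by blast
next
  case False
  then have k: "0 =\<^sub>v Q k" using k by blast
  then have "0 \<le>\<^sub>v - Q k" by (simp add: val_eq_iff)
  then obtain x y where "1 \<le>\<^sub>v Q b * (x * x) + Q w * (y * y) - (- Q k)"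
    using unit_binary_form_represents[OF bw] by blast
  moreover define u where "u = x *s b + y *s w + k"
  ultimately have Qu: "1 \<le>\<^sub>v Q u" and Buk: "B u k = Q k"
    using orth B_commute[of w b] B_commute[of k b] B_commute[of k w]
    by (simp_all add: B_simps algebra_simps)
  have u: "u \<in> W" unfolding u_def using W by (intro subspace_add subspace_scale)
  show thesis
  proof (cases "1 =\<^sub>v Q u")
    case True
    then show thesis using that u by blast
  next
    case False
    have "2 \<le>\<^sub>v \<pi> * \<pi> * Q k"
      using val_eq_mult[OF val_eq_mult[OF val_eq_pi val_eq_pi] k] by (simp add: val_eq_iff)
    then have "2 \<le>\<^sub>v Q u + \<pi> * \<pi> * Q k" using Qu False by (intro val_ge_add) (auto simp: val_eq_iff)
    moreover have "1 =\<^sub>v 2 * (\<pi> * Q k)"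
      using val_eq_mult_unit[OF val_eq_0_two] val_eq_mult[OF val_eq_pi k] by simp
    moreover have "Q (u + \<pi> *s k) = 2 * (\<pi> * Q k) + (Q u + \<pi> * \<pi> * Q k)"
      using B_commute[of k u] by (simp add: B_simps Buk algebra_simps)
    ultimately have "1 =\<^sub>v Q (u + \<pi> *s k)"
      using val_eq_add[of 1 "2 * (\<pi> * Q k)"] by simp
    then show thesis using that u W by (auto intro: subspace_add subspace_scale)
  qed
qed

section \<open>Conjugacy of unit frames\<close>

definition reflection :: "'v \<Rightarrow> 'v \<Rightarrow> 'v" where
  "reflection u x = x - (2 * B x u / Q u) *s u"

lemma isometry_on_reflection:
  assumes "Q u \<noteq> 0" shows "isometry_on UNIV (reflection u)"
proof -
  have "Vector_Spaces.linear (*s) (*s) (reflection u)"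
    using vector_space_axioms
    by (simp add: Vector_Spaces.linear_iff reflection_def B_simps algebra_simps add_divide_distrib)
  moreover have "Q (reflection u x) = Q x" for x
    using assms B_commute[of u x] by (simp add: reflection_def B_simps field_simps)
  ultimately show ?thesis by (simp add: isometry_on_def)
qed

lemma reflection_image_subset:
  assumes M: "integral_submodule M" and u: "u \<in> M" "0 =\<^sub>v Q u"
  shows "reflection u ` M \<subseteq> M"
proof (rule image_subsetI)
  fix x assume x: "x \<in> M"
  then have "0 \<le>\<^sub>v 2 * B x u / Q u"
    using integral_submodule_B[OF M x u(1)] val_eq_imp_val_ge[OF val_eq_0_two]
    by (intro val_ge_divide_unit[OF _ u(2)] val_ge_mult_left) auto
  then show "reflection u x \<in> M"
    unfolding reflection_def using x u(1) integral_submodule_imp_integer[OF M]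
    by (intro integer_submodule_diff integer_submodule_scale)
qed

lemma reflection_fixes: "B x u = 0 \<Longrightarrow> reflection u x = x"
  by (simp add: reflection_def)

lemma reflection_swap:
  assumes "Q x = Q y" "Q (x - y) \<noteq> 0" shows "reflection (x - y) x = y"
proof -
  have "2 * B x (x - y) = Q (x - y)"
    using assms by (simp add: B_simps B_commute[of y x])
  then show ?thesis using assms(2) by (simp add: reflection_def)
qed

lemma reflection_self: "Q u \<noteq> 0 \<Longrightarrow> reflection u (- u) = u"
  using scale_left_distrib[of 1 1 u] by (simp add: reflection_def B_simps)

text \<open>The sum of the two norms is \<open>4 Q y\<close>.\<close>

lemma unit_norm_diff_or_sum:
  assumes M: "integral_submodule M" and xy: "x \<in> M" "y \<in> M" "Q x = Q y" "0 =\<^sub>v Q y"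
  shows "0 =\<^sub>v Q (x - y) \<or> 0 =\<^sub>v Q (x - (- y))"
proof (rule ccontr)
  assume nonunit: "\<not> ?thesis"
  have "integer_submodule M" using M by (rule integral_submodule_imp_integer)
  then have "x - y \<in> M" "x - (- y) \<in> M"
    using xy by (auto simp: integer_submodule_diff integer_submodule_add)
  then have "1 \<le>\<^sub>v Q (x - y) + Q (x - (- y))"
    using nonunit integral_submodule_Q[OF M] by (intro val_ge_add) (auto simp: val_eq_iff)
  also have "Q (x - y) + Q (x - (- y)) = 2 * (2 * Q y)"
    using xy by (simp add: B_simps B_commute[of y x])
  finally show False
    using val_eq_mult_unit[OF val_eq_0_two val_eq_mult_unit[OF val_eq_0_two xy(4)]]
    by (simp add: val_eq_iff)
qed

lemma unit_vector_conjugate: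
  assumes M: "integral_submodule M" and xy: "x \<in> M" "y \<in> M" "Q x = Q y" "0 =\<^sub>v Q y"
  obtains h where "isometry_on UNIV h" "h ` M \<subseteq> M" "h x = y"
    "\<And>w. B w x = 0 \<Longrightarrow> B w y = 0 \<Longrightarrow> h w = w"
proof (cases "0 =\<^sub>v Q (x - y)")
  case True
  have "x - y \<in> M" using xy M by (simp add: integral_submodule_def integer_submodule_diff)
  then show thesis
    using that[of "reflection (x - y)"] isometry_on_reflection reflection_image_subset[OF M _ True]
      reflection_swap[OF xy(3)] val_eq_nonzero[OF True] by (simp add: reflection_fixes B_simps)
next
  case False
  then have unit: "0 =\<^sub>v Q (x - (- y))" using unit_norm_diff_or_sum[OF assms] by blast
  have mem: "x - (- y) \<in> M"
    using xy M integer_submodule_add[of M x y] by (simp add: integral_submodule_def)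
  have nonzero: "Q (x - (- y)) \<noteq> 0" "Q y \<noteq> 0" using val_eq_nonzero unit xy(4) by blast+
  let ?h = "reflection y \<circ> reflection (x - (- y))"
  show thesis
  proof (rule that)
    show "isometry_on UNIV ?h"
      using nonzero by (intro isometry_on_compose isometry_on_reflection)
    show "?h ` M \<subseteq> M"
      using reflection_image_subset[OF M mem unit] reflection_image_subset[OF M xy(2,4)]
      by (auto simp: image_comp [symmetric])
    have "reflection (x - (- y)) x = - y"
      using xy nonzero by (intro reflection_swap) (simp_all add: B_simps)
    then show "?h x = y" using nonzero(2) by (simp add: reflection_self)
    show "?h w = w" if "B w x = 0" "B w y = 0" for w
      using that by (simp add: reflection_fixes B_simps)
  qed
qed

lemma unit_frame_conjugate:
  assumes M: "integral_submodule M" and "unit_frame X" "X \<subseteq> M" "\<phi> ` X \<subseteq> M"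
    and "\<And>x y. x \<in> X \<Longrightarrow> y \<in> X \<Longrightarrow> B (\<phi> x) (\<phi> y) = B x y"
  shows "\<exists>g. isometry_on UNIV g \<and> g ` M \<subseteq> M \<and> (\<forall>x\<in>X. g (\<phi> x) = x)"
  using unit_frameD(2)[OF assms(2)] assms(2-)
proof (induction X rule: finite_induct)
  case empty
  show ?case by (rule exI[of _ "\<lambda>x. x"]) (simp add: isometry_on_id)
next
  case (insert a X)
  have "unit_frame X" using insert.prems(1) by (rule unit_frame_subset) blast
  moreover have a: "0 =\<^sub>v Q a" "a \<in> M" using insert.prems unit_frameD(3) by auto
  ultimately obtain g where g: "isometry_on UNIV g" "g ` M \<subseteq> M" "\<forall>x\<in>X. g (\<phi> x) = x"
    using insert by auto
  have g_B: "B (g x) (g y) = B x y" for x y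
    using g(1) linear_preserves_B[of g UNIV] by (simp add: isometry_on_def subspace_UNIV)
  have "g (\<phi> a) \<in> M" "Q (g (\<phi> a)) = Q a" using insert.prems g(2) g_B by auto
  then obtain h where h: "isometry_on UNIV h" "h ` M \<subseteq> M" "h (g (\<phi> a)) = a"
    "\<And>w. B w (g (\<phi> a)) = 0 \<Longrightarrow> B w a = 0 \<Longrightarrow> h w = w"
    using unit_vector_conjugate[OF M _ a(2) _ a(1)] by metis
  have "h x = x" if x: "x \<in> X" for x
  proof (rule h(4))
    show "B x a = 0"
      using orthogonal_frameD(3)[OF unit_frameD(1)[OF insert.prems(1)], of x a] x insert.hyps(2) by auto
    moreover have "B (g (\<phi> x)) (g (\<phi> a)) = B x a" using g_B insert.prems(4) x by simp
    ultimately show "B x (g (\<phi> a)) = 0" using g(3) x by simp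
  qed
  show ?case
  proof (intro exI conjI)
    show "isometry_on UNIV (h \<circ> g)" by (rule isometry_on_compose[OF g(1) h(1)])
  qed (use \<open>\<And>x. x \<in> X \<Longrightarrow> h x = x\<close> g h in \<open>auto simp: image_subset_iff\<close>)
qed

end

section \<open>Saturated unit frames in a non-degenerate space\<close>

locale nondegenerate_space = quadratic_ambient v scale B
  for v :: "'f::field \<Rightarrow> int" and scale :: "'f \<Rightarrow> 'v::ab_group_add \<Rightarrow> 'v" (infixr \<open>*s\<close> 75)
    and B :: "'v \<Rightarrow> 'v \<Rightarrow> 'f" +
  fixes V :: "'v set"
  assumes subspace_V: "subspace V"
    and finitely_spanned: "\<exists>S. finite S \<and> V = span S"
    and nondegenerate_V: "nondegenerate B V"
begin

lemma subspace_V_perp: "subspace (V \<inter> perp X)"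
  using subspace_V subspace_perp by (rule subspace_inter)

lemma orthogonal_frame_card_le: "orthogonal_frame X \<Longrightarrow> X \<subseteq> V \<Longrightarrow> card X \<le> dim V"
  using finitely_spanned card_independent_le_dim orthogonal_frame_independent by blast

lemma eq_zero_if_perp_full_frame:
  assumes X: "orthogonal_frame X" "X \<subseteq> V" "card X = dim V" and x: "x \<in> V \<inter> perp X"
  shows "x = 0"
proof -
  have "V \<subseteq> span X"
    using finitely_spanned subset_span_if_dim_le_card[OF _ _ orthogonal_frame_independent[OF X(1)]] X
    by (metis order_refl)
  then show ?thesis using eq_zero_if_span_perp[OF X(1)] x by blast
qed

lemma anisotropic_vector_perp_exists:
  assumes X: "orthogonal_frame X" "X \<subseteq> V" "card X < dim V"
  obtains z where "z \<in> V \<inter> perp X" "Q z \<noteq> 0"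
proof -
  have proj_mem: "proj X y \<in> V \<inter> perp X" if "y \<in> V" for y
    using proj_mem_subspace[OF subspace_V X(2) that] proj_mem_perp[OF X(1)] by blast
  have "\<not> V \<subseteq> span X"
    using X dim_le_card[of V X] orthogonal_frameD(1) by auto
  then obtain x where x: "x \<in> V" "x \<notin> span X" by blast
  define a where "a = proj X x"
  have "a \<noteq> 0" using x(2) diff_proj_mem_span[of x X] by (auto simp: a_def)
  moreover have a: "a \<in> V \<inter> perp X" using proj_mem x(1) by (simp add: a_def)
  ultimately obtain y where y: "y \<in> V" "B a y \<noteq> 0"
    using nondegenerate_V by (auto simp: nondegenerate_def)
  define b where "b = proj X y"
  have b: "b \<in> V \<inter> perp X" "B a b \<noteq> 0"
    using proj_mem y a B_proj[of a X y] by (simp_all add: b_def)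
  have "Q (a + b) \<noteq> 0 \<or> Q a \<noteq> 0 \<or> Q b \<noteq> 0"
    using b(2) polarization[of a b] by auto
  moreover have "a + b \<in> V \<inter> perp X" using subspace_V_perp a b(1) by (rule subspace_add)
  ultimately show thesis using that a b by blast
qed

lemma val_0_1_vector_perp_exists:
  assumes X: "orthogonal_frame X" "X \<subseteq> V" "card X < dim V"
  obtains z where "z \<in> V \<inter> perp X" "0 =\<^sub>v Q z \<or> 1 =\<^sub>v Q z"
proof -
  obtain z where z: "z \<in> V \<inter> perp X" "Q z \<noteq> 0" by (rule anisotropic_vector_perp_exists[OF X])
  obtain c where "0 =\<^sub>v c * c * Q z \<or> 1 =\<^sub>v c * c * Q z"
    using exists_square_mult_val_0_1[OF z(2)] .
  then have "0 =\<^sub>v Q (c *s z) \<or> 1 =\<^sub>v Q (c *s z)" by (simp add: B_simps mult.assoc)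
  moreover have "c *s z \<in> V \<inter> perp X" using subspace_V_perp z(1) by (rule subspace_scale)
  ultimately show thesis using that by blast
qed

definition saturated :: "'v set \<Rightarrow> bool" where
  "saturated X \<longleftrightarrow> unit_frame X \<and> X \<subseteq> V \<and> (\<forall>x\<in>V \<inter> perp X. \<not> 0 =\<^sub>v Q x)"

lemma saturated_frame: "saturated X \<Longrightarrow> orthogonal_frame X" "saturated X \<Longrightarrow> X \<subseteq> V"
  by (simp_all add: saturated_def unit_frame_def)

lemma saturated_exists: "\<exists>X. saturated X"
proof -
  let ?P = "\<lambda>X. unit_frame X \<and> X \<subseteq> V"
  have "?P {}" by (simp add: unit_frame_empty)
  moreover have "\<forall>X. ?P X \<longrightarrow> card X < Suc (dim V)"
    using orthogonal_frame_card_le unit_frameD(1) less_Suc_eq_le by blast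
  ultimately obtain X where X: "?P X" and greatest: "\<And>Y. ?P Y \<Longrightarrow> card Y \<le> card X"
    using ex_has_greatest_nat[of ?P "{}" card "Suc (dim V)"] by blast
  have "\<not> 0 =\<^sub>v Q x" if x: "x \<in> V \<inter> perp X" for x
  proof
    assume "0 =\<^sub>v Q x"
    then have "unit_frame (insert x X)" "x \<notin> X" using unit_frame_insert X x by blast+
    then have "card (insert x X) \<le> card X" using X x by (intro greatest) auto
    then show False using \<open>x \<notin> X\<close> X unit_frameD(2) by auto
  qed
  with X show ?thesis by (auto simp: saturated_def)
qed

lemma saturated_Q: "saturated X \<Longrightarrow> x \<in> V \<inter> perp X \<Longrightarrow> 0 \<le>\<^sub>v Q x \<Longrightarrow> 1 \<le>\<^sub>v Q x"
  by (auto simp: saturated_def val_eq_iff)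

text \<open>If \<open>B x y\<close> were not in the maximal ideal, rescaling \<open>x\<close> would make \<open>Q (x + y)\<close> a unit.\<close>

lemma saturated_B:
  assumes X: "saturated X" and x: "x \<in> V \<inter> perp X" "0 \<le>\<^sub>v Q x" and y: "y \<in> V \<inter> perp X" "0 \<le>\<^sub>v Q y"
  shows "1 \<le>\<^sub>v B x y"
proof (rule ccontr)
  assume "\<not> 1 \<le>\<^sub>v B x y"
  then have "B x y \<noteq> 0" "v (B x y) \<le> 0" by (auto simp: val_ge_def)
  define c where "c = inverse (B x y)"
  have c: "0 \<le>\<^sub>v c" "c * B x y = 1"
    using \<open>B x y \<noteq> 0\<close> \<open>v (B x y) \<le> 0\<close> by (simp_all add: c_def val_ge_def val_inverse)
  have cx: "c *s x \<in> V \<inter> perp X" using subspace_V_perp x(1) by (rule subspace_scale)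
  have "0 \<le>\<^sub>v Q (c *s x)" using c(1) x(2) by (simp add: B_simps val_ge_mult_left)
  then have "1 \<le>\<^sub>v Q (c *s x) + Q y"
    using saturated_Q[OF X cx] saturated_Q[OF X y] by (intro val_ge_add)
  moreover have "Q (c *s x + y) = 2 + (Q (c *s x) + Q y)"
    using c(2) B_commute[of y x] by (simp add: B_simps distrib_left)
  ultimately have "0 =\<^sub>v Q (c *s x + y)"
    using val_eq_add[OF val_eq_0_two, of "Q (c *s x) + Q y"] by simp
  moreover have "c *s x + y \<in> V \<inter> perp X" using subspace_V_perp cx y(1) by (rule subspace_add)
  ultimately show False using X by (simp add: saturated_def)
qed

lemma saturated_coefficient:
  assumes X: "saturated X" and x: "x \<in> V \<inter> perp X" "0 \<le>\<^sub>v Q x" and y: "y \<in> V \<inter> perp X" "1 =\<^sub>v Q y"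
  shows "0 \<le>\<^sub>v B x y / Q y"
  using val_ge_divide[OF saturated_B[OF X x y(1)] y(2)] val_eq_imp_val_ge[OF y(2), of 0] by simp

lemma saturated_prime_perp_exists:
  assumes X: "saturated X" and Y: "orthogonal_frame (Y \<union> X)" "Y \<subseteq> V" "card (Y \<union> X) < dim V"
  obtains z where "z \<in> V \<inter> perp (Y \<union> X)" "1 =\<^sub>v Q z"
proof -
  obtain z where z: "z \<in> V \<inter> perp (Y \<union> X)" "0 =\<^sub>v Q z \<or> 1 =\<^sub>v Q z"
    using val_0_1_vector_perp_exists[OF Y(1) _ Y(3)] Y(2) saturated_frame(2)[OF X] by blast
  moreover have "z \<in> V \<inter> perp X" using z(1) perp_antimono[of X "Y \<union> X"] by blast
  ultimately show thesis using that X unfolding saturated_def by blast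
qed

lemma saturated_no_prime_triple:
  assumes X: "saturated X" and mem: "a \<in> V \<inter> perp X" "b \<in> V \<inter> perp X" "c \<in> V \<inter> perp X"
    and orth: "B a b = 0" "B a c = 0" "B b c = 0"
    and primes: "1 =\<^sub>v Q a" "1 =\<^sub>v Q b" "1 =\<^sub>v Q c"
  shows False
proof -
  have "1 \<le>\<^sub>v - Q c" using primes(3) by (simp add: val_eq_iff)
  then obtain x y where xy: "2 \<le>\<^sub>v Q a * (x * x) + Q b * (y * y) - (- Q c)"
    using binary_form_represents[OF primes(1,2)] by (metis one_add_one)
  define w where "w = (1 / \<pi>) *s (x *s a + y *s b + c)"
  have w: "w \<in> V \<inter> perp X"
    unfolding w_def using subspace_V_perp mem by (intro subspace_scale subspace_add)
  have "Q w = (Q a * (x * x) + Q b * (y * y) - (- Q c)) / (\<pi> * \<pi>)"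
    using orth B_commute[of b a] B_commute[of c a] B_commute[of c b]
    by (simp add: w_def B_simps field_simps)
  then have "0 \<le>\<^sub>v Q w" using val_ge_divide[OF xy val_eq_mult[OF val_eq_pi val_eq_pi]] by simp
  then have "1 \<le>\<^sub>v B w c"
    using saturated_B[OF X w _ mem(3)] val_eq_imp_val_ge[OF primes(3)] by simp
  moreover have "B w c = Q c / \<pi>" by (simp add: w_def B_simps orth)
  ultimately show False using val_eq_divide[OF primes(3) val_eq_pi] by (simp add: val_eq_iff)
qed

lemma saturated_card:
  assumes X: "saturated X" shows "dim V \<le> card X + 2"
proof (rule ccontr)
  assume small: "\<not> ?thesis"
  have finite: "finite X" using saturated_frame(1)[OF X] by (rule orthogonal_frameD)
  obtain a where a: "a \<in> V \<inter> perp X" "1 =\<^sub>v Q a"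
    using saturated_prime_perp_exists[OF X, of "{}"] saturated_frame[OF X] small by auto
  have aX: "orthogonal_frame (insert a X)"
    using orthogonal_frame_insert(1)[OF saturated_frame(1)[OF X]] a val_eq_nonzero by blast
  have "card (insert a X) < dim V" using finite small by (simp add: card_insert_if)
  then obtain b where b: "b \<in> V \<inter> perp (insert a X)" "1 =\<^sub>v Q b"
    using saturated_prime_perp_exists[OF X, of "{a}"] aX a by auto
  have baX: "orthogonal_frame (insert b (insert a X))"
    using orthogonal_frame_insert(1)[OF aX] b val_eq_nonzero by blast
  have "card (insert b (insert a X)) < dim V" using finite small by (simp add: card_insert_if)
  then obtain c where "c \<in> V \<inter> perp (insert b (insert a X))" "1 =\<^sub>v Q c"
    using saturated_prime_perp_exists[OF X, of "{b, a}"] baX a b by auto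
  then show False
    using saturated_no_prime_triple[OF X, of a b c] a b B_commute by auto
qed

end

section \<open>ADC lattices are maximal\<close>

definition (in quadratic_ambient) represents_frames :: "nat \<Rightarrow> 'v set \<Rightarrow> 'v set \<Rightarrow> bool" where
  "represents_frames n V M \<longleftrightarrow>
     (\<forall>Y. orthogonal_frame Y \<longrightarrow> Y \<subseteq> V \<longrightarrow> card Y = n \<longrightarrow> (\<forall>y\<in>Y. 0 \<le>\<^sub>v Q y) \<longrightarrow>
        (\<exists>\<phi>. \<phi> ` Y \<subseteq> M \<and> (\<forall>x\<in>Y. \<forall>y\<in>Y. B (\<phi> x) (\<phi> y) = B x y)))"

locale frame_ADC_lattice = nondegenerate_space v scale B V
  for v :: "'f::field \<Rightarrow> int" and scale :: "'f \<Rightarrow> 'v::ab_group_add \<Rightarrow> 'v" (infixr \<open>*s\<close> 75)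
    and B :: "'v \<Rightarrow> 'v \<Rightarrow> 'f" and V :: "'v set" +
  fixes n :: nat and M :: "'v set"
  assumes integral_M: "integral_submodule M" and M_subset_V: "M \<subseteq> V"
    and n_ge_2: "2 \<le> n" and dim_V: "dim V = n + 1 \<or> dim V = n + 2"
    and represents_frames: "represents_frames n V M"
begin

lemma integer_submodule_M: "integer_submodule M"
  using integral_M by (rule integral_submodule_imp_integer)

lemma integer_submodule_M_perp: "integer_submodule (M \<inter> perp X)"
  using integer_submodule_M subspace_imp_integer_submodule[OF subspace_perp]
  by (rule integer_submodule_Int)

text \<open>
  For such \<open>X\<close> and \<open>Y\<close>, the \<open>\<O>\<close>-span of \<open>X \<union> Y\<close> contains every vector of \<open>V\<close> that has integral norm
  and integral products with \<open>X\<close>.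
\<close>

definition maximality_frame :: "'v set \<Rightarrow> 'v set \<Rightarrow> bool" where
  "maximality_frame X Y \<longleftrightarrow>
     unit_frame X \<and> orthogonal_frame (X \<union> Y) \<and> X \<union> Y \<subseteq> M \<and> card (X \<union> Y) = dim V \<and>
     (\<forall>x\<in>V \<inter> perp X. 0 \<le>\<^sub>v Q x \<longrightarrow> (\<forall>y\<in>Y. 0 \<le>\<^sub>v B x y / Q y))"

lemma maximality_frame_imp_overmodule_subset:
  assumes XY: "maximality_frame X Y" and K: "integral_submodule K" "M \<subseteq> K" "K \<subseteq> V"
  shows "K \<subseteq> M"
proof
  fix x assume x: "x \<in> K"
  have X: "unit_frame X" "X \<subseteq> K" and Z: "orthogonal_frame (X \<union> Y)" "X \<union> Y \<subseteq> M" "card (X \<union> Y) = dim V"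
    using XY K(2) by (auto simp: maximality_frame_def)
  have coeff_X: "0 \<le>\<^sub>v B x y / Q y" if "y \<in> X" for y
    using unit_frame_coefficient[OF K(1) X x that] .
  have "proj X x \<in> K" using proj_mem_integral_submodule[OF K(1) X x] .
  then have p: "proj X x \<in> V \<inter> perp X" "0 \<le>\<^sub>v Q (proj X x)"
    using K proj_mem_perp[OF unit_frameD(1)[OF X(1)]] integral_submodule_Q by auto
  have coeff_Y: "0 \<le>\<^sub>v B x y / Q y" if y: "y \<in> Y - X" for y
  proof -
    have "y \<in> perp X" using y orthogonal_frameD(3)[OF Z(1)] by (auto simp: perp_def)
    then have "B (proj X x) y = B x y" using B_proj[of y X x] B_commute by simp
    then show ?thesis using XY p y unfolding maximality_frame_def by (metis DiffD1)
  qed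
  have "x - proj (X \<union> Y) x \<in> M"
    using coeff_X coeff_Y by (intro diff_proj_mem[OF integer_submodule_M Z(2)]) blast
  moreover have "X \<union> Y \<subseteq> V" using Z(2) M_subset_V by blast
  then have "proj (X \<union> Y) x \<in> V" using x K(3) by (intro proj_mem_subspace[OF subspace_V]) auto
  then have "proj (X \<union> Y) x = 0"
    using eq_zero_if_perp_full_frame[OF Z(1) \<open>X \<union> Y \<subseteq> V\<close> Z(3)] proj_mem_perp[OF Z(1)] by blast
  ultimately show "x \<in> M" by simp
qed

lemma unit_frame_insert_represents:
  assumes X: "unit_frame X" "X \<subseteq> V" "card X = n - 1"
    and z: "z \<in> V \<inter> perp X" "Q z \<noteq> 0" "0 \<le>\<^sub>v Q z"
  obtains \<phi> where "\<phi> ` insert z X \<subseteq> M"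
    "\<And>x y. x \<in> insert z X \<Longrightarrow> y \<in> insert z X \<Longrightarrow> B (\<phi> x) (\<phi> y) = B x y"
proof -
  have "orthogonal_frame (insert z X)" "z \<notin> X"
    using orthogonal_frame_insert[OF unit_frameD(1)[OF X(1)]] z by blast+
  moreover have "\<forall>y\<in>insert z X. 0 \<le>\<^sub>v Q y"
    using z(3) unit_frameD(3)[OF X(1)] by (auto intro: val_eq_imp_val_ge)
  moreover have "card (insert z X) = n" using \<open>z \<notin> X\<close> X n_ge_2 unit_frameD(2) by simp
  moreover have "insert z X \<subseteq> V" using z X by blast
  ultimately show thesis
    using represents_frames that unfolding represents_frames_def by metis
qed

lemma unit_frame_in_M_exists:
  obtains X where "unit_frame X" "X \<subseteq> M" "card X = n - 1"
proof -
  obtain S where S: "saturated S" using saturated_exists by blast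
  then have "n - 1 \<le> card S" using saturated_card dim_V by fastforce
  then obtain X where "X \<subseteq> S" "card X = n - 1" using obtain_subset_with_card_n by metis
  then have X: "unit_frame X" "X \<subseteq> V" "card X = n - 1"
    using S unit_frame_subset by (auto simp: saturated_def)
  moreover have "card X < dim V" using X(3) dim_V n_ge_2 by linarith
  ultimately obtain z where "z \<in> V \<inter> perp X" "0 =\<^sub>v Q z \<or> 1 =\<^sub>v Q z"
    using val_0_1_vector_perp_exists unit_frameD(1) by metis
  then obtain \<phi> where \<phi>: "\<phi> ` insert z X \<subseteq> M"
    "\<And>x y. x \<in> insert z X \<Longrightarrow> y \<in> insert z X \<Longrightarrow> B (\<phi> x) (\<phi> y) = B x y"
    using unit_frame_insert_represents[OF X] val_eq_nonzero val_eq_imp_val_ge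
    by (metis order_refl zero_le_one)
  have "inj_on \<phi> X"
  proof (rule inj_onI, rule ccontr)
    fix x y assume xy: "x \<in> X" "y \<in> X" "\<phi> x = \<phi> y" "x \<noteq> y"
    then have "Q x = B x y" using \<phi>(2) by (metis insertI2)
    then show False using xy orthogonal_frameD(2,3)[OF unit_frameD(1)[OF X(1)]] by metis
  qed
  moreover have "unit_frame (\<phi> ` X)"
    using X(1) \<phi>(2) by (auto simp: unit_frame_def orthogonal_frame_def)
  ultimately show thesis using that[of "\<phi> ` X"] \<phi>(1) X(3) by (simp add: card_image)
qed

lemma perp_represents:
  assumes X: "unit_frame X" "X \<subseteq> M" "card X = n - 1"
    and z: "z \<in> V \<inter> perp X" "Q z \<noteq> 0" "0 \<le>\<^sub>v Q z"
  obtains y where "y \<in> M \<inter> perp X" "Q y = Q z"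
proof -
  obtain \<phi> where \<phi>: "\<phi> ` insert z X \<subseteq> M"
    "\<And>x y. x \<in> insert z X \<Longrightarrow> y \<in> insert z X \<Longrightarrow> B (\<phi> x) (\<phi> y) = B x y"
    using unit_frame_insert_represents[OF X(1) _ X(3) z] X(2) M_subset_V by blast
  obtain g where g: "isometry_on UNIV g" "g ` M \<subseteq> M" "\<forall>x\<in>X. g (\<phi> x) = x"
    using unit_frame_conjugate[OF integral_M X(1,2), of \<phi>] \<phi> by auto
  have g_B: "B (g x) (g y) = B x y" for x y
    using g(1) linear_preserves_B[of g UNIV] by (simp add: isometry_on_def subspace_UNIV)
  have "B (g (\<phi> z)) x = 0" if x: "x \<in> X" for x
  proof -
    have "B (g (\<phi> z)) (g (\<phi> x)) = B z x" using g_B \<phi>(2) x by simp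
    then show ?thesis using g(3) x z(1) by (simp add: perp_def)
  qed
  then have "g (\<phi> z) \<in> M \<inter> perp X" using g(2) \<phi>(1) by (auto simp: perp_def)
  moreover have "Q (g (\<phi> z)) = Q z" using g_B \<phi>(2) by simp
  ultimately show thesis by (rule that)
qed

subsection \<open>A saturated unit frame in the lattice\<close>

definition represents_perp_primes :: "'v set \<Rightarrow> bool" where
  "represents_perp_primes X \<longleftrightarrow>
     (\<forall>z\<in>V \<inter> perp X. 1 =\<^sub>v Q z \<longrightarrow> (\<exists>m\<in>M \<inter> perp X. 2 \<le>\<^sub>v Q z - Q m))"

lemma maximality_frame_if_saturated:
  assumes "saturated X" "X \<subseteq> M" "orthogonal_frame (X \<union> Y)" "card (X \<union> Y) = dim V"
    "Y \<subseteq> M \<inter> perp X" "\<And>y. y \<in> Y \<Longrightarrow> 1 =\<^sub>v Q y"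
  shows "maximality_frame X Y"
proof -
  have "0 \<le>\<^sub>v B x y / Q y" if "x \<in> V \<inter> perp X" "0 \<le>\<^sub>v Q x" "y \<in> Y" for x y
    using saturated_coefficient[OF assms(1) that(1,2)] assms(5,6) that(3) M_subset_V by blast
  with assms(1-5) show ?thesis unfolding maximality_frame_def saturated_def by blast
qed

lemma second_prime_vector_exists:
  assumes X: "saturated X" and rep: "represents_perp_primes X"
    and m: "m \<in> M \<inter> perp X" "1 =\<^sub>v Q m" and dim: "card X + 1 < dim V"
  obtains z where "z \<in> M \<inter> perp (insert m X)" "1 =\<^sub>v Q z"
proof -
  have mV: "m \<in> V \<inter> perp X" using m(1) M_subset_V by blast
  have mX: "orthogonal_frame (insert m X)" "m \<notin> X"
    using orthogonal_frame_insert[OF saturated_frame(1)[OF X]] m val_eq_nonzero by blast+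
  then have "card (insert m X) < dim V"
    using dim orthogonal_frameD(1)[OF saturated_frame(1)[OF X]] by simp
  then obtain k where "k \<in> V \<inter> perp (insert m X)" "1 =\<^sub>v Q k"
    using saturated_prime_perp_exists[OF X, of "{m}"] mX mV by auto
  then have k: "k \<in> V \<inter> perp X" "B m k = 0" "1 =\<^sub>v Q k" using B_commute by auto
  obtain \<Delta> where \<Delta>: "0 =\<^sub>v \<Delta>" "\<not> residue_square \<Delta>" by (rule residue_nonsquare_exists)
  obtain y where y: "y \<in> V \<inter> perp X" "2 \<le>\<^sub>v \<Delta> * Q m - Q y" "1 =\<^sub>v Q y"
    using orthogonal_pair_nonsquare_norm[OF subspace_V_perp mV k(1,2) m(2) k(3) \<Delta>(1)]
    by (metis one_add_one)
  then obtain m' where m': "m' \<in> M \<inter> perp X" "2 \<le>\<^sub>v Q y - Q m'"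
    using rep by (auto simp: represents_perp_primes_def)
  define \<beta> where "\<beta> = B m' m / Q m"
  have \<beta>: "0 \<le>\<^sub>v \<beta>" "B m' m = \<beta> * Q m"
    using m'(1) M_subset_V integral_submodule_Q[OF integral_M] val_eq_nonzero[OF m(2)]
      saturated_coefficient[OF X _ _ mV m(2), of m'] by (auto simp: \<beta>_def)
  have "2 \<le>\<^sub>v \<Delta> * Q m - Q m'" using y(2) m'(2) by (rule val_ge_diff_trans)
  then have "1 =\<^sub>v Q (m' - \<beta> *s m)"
    using split_off_vector_val_eq[OF integer_submodule_M_perp m(1) m'(1) \<beta> m(2) \<Delta>] by simp
  then show thesis
    using that[of "m' - \<beta> *s m"] split_off_vector(1,2)[OF integer_submodule_M_perp m(1) m'(1) \<beta>]
    by simp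
qed

lemma saturated_imp_maximality_frame:
  assumes X: "saturated X" "X \<subseteq> M" and rep: "represents_perp_primes X" and dim: "card X < dim V"
  shows "\<exists>Y. maximality_frame X Y"
proof -
  have fin: "finite X" using saturated_frame(1)[OF X(1)] by (rule orthogonal_frameD)
  obtain k where "k \<in> V \<inter> perp X" "1 =\<^sub>v Q k"
    using saturated_prime_perp_exists[OF X(1), of "{}"] saturated_frame[OF X(1)] dim by auto
  then obtain m where m: "m \<in> M \<inter> perp X" "2 \<le>\<^sub>v Q k - Q m"
    using rep by (auto simp: represents_perp_primes_def)
  then have Qm: "1 =\<^sub>v Q m" using val_eq_cong \<open>1 =\<^sub>v Q k\<close> by simp
  have mX: "orthogonal_frame (insert m X)" "m \<notin> X"
    using orthogonal_frame_insert[OF saturated_frame(1)[OF X(1)]] m Qm val_eq_nonzero by blast+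
  show ?thesis
  proof (cases "card X + 1 = dim V")
    case True
    then have "maximality_frame X {m}"
      using mX m Qm fin by (intro maximality_frame_if_saturated[OF X]) auto
    then show ?thesis by blast
  next
    case False
    then have "card X + 1 < dim V" using dim by simp
    then obtain z where z: "z \<in> M \<inter> perp (insert m X)" "1 =\<^sub>v Q z"
      using second_prime_vector_exists[OF X(1) rep m(1) Qm] by blast
    have zmX: "orthogonal_frame (insert z (insert m X))" "z \<notin> insert m X"
      using orthogonal_frame_insert[OF mX(1)] z val_eq_nonzero by blast+
    have "card X + 2 = dim V" using saturated_card[OF X(1)] \<open>card X + 1 < dim V\<close> by simp
    then have "maximality_frame X {z, m}"
      using zmX mX m z Qm fin by (intro maximality_frame_if_saturated[OF X]) auto
    then show ?thesis by blast
  qed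
qed

lemma unit_frame_represents_perp_primes:
  assumes "unit_frame X" "X \<subseteq> M" "card X = n - 1"
  shows "represents_perp_primes X"
  unfolding represents_perp_primes_def
proof (intro ballI impI)
  fix z assume z: "z \<in> V \<inter> perp X" "1 =\<^sub>v Q z"
  then obtain y where "y \<in> M \<inter> perp X" "Q y = Q z"
    using perp_represents[OF assms z(1)] val_eq_nonzero val_eq_imp_val_ge[OF z(2), of 0] by auto
  then show "\<exists>m\<in>M \<inter> perp X. 2 \<le>\<^sub>v Q z - Q m" by (intro bexI[of _ y]) simp_all
qed

lemma insert_represents_perp_primes:
  assumes X: "unit_frame X" "X \<subseteq> M" "card X = n - 1"
    and b: "b \<in> M \<inter> perp X" "0 =\<^sub>v Q b" and sat: "saturated (insert b X)"
  shows "represents_perp_primes (insert b X)"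
  unfolding represents_perp_primes_def
proof (intro ballI impI)
  fix z assume z: "z \<in> V \<inter> perp (insert b X)" "1 =\<^sub>v Q z"
  then obtain y where y: "y \<in> M \<inter> perp X" "Q y = Q z"
    using perp_represents[OF X, of z] val_eq_nonzero val_eq_imp_val_ge[OF z(2), of 0] by auto
  obtain \<beta> where \<beta>: "0 \<le>\<^sub>v \<beta>" "B y b = \<beta> * Q b"
    using unit_coefficient_exists[OF integral_M _ _ b(2), of y] b y by blast
  note split = split_off_vector[OF integer_submodule_M_perp b(1) y(1) \<beta>]
  have m: "y - \<beta> *s b \<in> M \<inter> perp (insert b X)" using split(1,2) by simp
  have "1 \<le>\<^sub>v Q (y - \<beta> *s b)"
    using m M_subset_V integral_submodule_Q[OF integral_M] by (intro saturated_Q[OF sat]) auto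
  moreover have "1 \<le>\<^sub>v Q y" using z(2) by (simp add: y(2) val_eq_iff)
  ultimately have "1 \<le>\<^sub>v Q y - Q (y - \<beta> *s b)" by (intro val_ge_diff)
  then have "1 \<le>\<^sub>v Q b * (\<beta> * \<beta>)" using split(3) by (simp add: mult.commute)
  then have "2 \<le>\<^sub>v Q b * (\<beta> * \<beta>)"
    using b(2) val_ge_2_square by (simp add: val_ge_mult_unit_iff val_ge_1_square_iff)
  then have "2 \<le>\<^sub>v Q z - Q (y - \<beta> *s b)" using split(3) y(2) by (simp add: mult.commute)
  then show "\<exists>m\<in>M \<inter> perp (insert b X). 2 \<le>\<^sub>v Q z - Q m" using m by blast
qed

subsection \<open>An unsaturated unit frame in the lattice\<close>

lemma unit_vector_perp_exists:
  assumes X: "unit_frame X" "X \<subseteq> M" "card X = n - 1" and unsat: "\<not> saturated X"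
  obtains b where "b \<in> M \<inter> perp X" "0 =\<^sub>v Q b"
proof -
  obtain a where a: "a \<in> V \<inter> perp X" "0 =\<^sub>v Q a"
    using X unsat M_subset_V by (auto simp: saturated_def)
  then obtain b where "b \<in> M \<inter> perp X" "Q b = Q a"
    using perp_represents[OF X a(1)] val_eq_nonzero val_eq_imp_val_ge[OF a(2), of 0] by auto
  then show thesis using that a(2) by simp
qed

lemma second_unit_vector_exists:
  assumes X: "unit_frame X" "X \<subseteq> M" "card X = n - 1"
    and b: "b \<in> M \<inter> perp X" "0 =\<^sub>v Q b" and unsat: "\<not> saturated (insert b X)"
  obtains w where "w \<in> M \<inter> perp (insert b X)" "0 =\<^sub>v Q w"
proof -
  have bV: "b \<in> V \<inter> perp X" using b(1) M_subset_V by blast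
  obtain a where a: "a \<in> V \<inter> perp X" "B b a = 0" "0 =\<^sub>v Q a"
    using unsat unit_frame_insert(1)[OF X(1) _ b(2)] b(1) bV X(2) M_subset_V B_commute
    by (auto simp: saturated_def)
  obtain \<Delta> where \<Delta>: "0 =\<^sub>v \<Delta>" "\<not> residue_square \<Delta>" by (rule residue_nonsquare_exists)
  obtain u where u: "u \<in> V \<inter> perp X" "1 \<le>\<^sub>v \<Delta> * Q b - Q u" "0 =\<^sub>v Q u"
    using orthogonal_pair_nonsquare_norm[OF subspace_V_perp bV a(1,2) b(2) a(3) \<Delta>(1)]
    by (metis add_0)
  then obtain m where m: "m \<in> M \<inter> perp X" "Q m = Q u"
    using perp_represents[OF X u(1)] val_eq_nonzero val_eq_imp_val_ge by blast
  obtain \<beta> where \<beta>: "0 \<le>\<^sub>v \<beta>" "B m b = \<beta> * Q b"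
    using unit_coefficient_exists[OF integral_M _ _ b(2), of m] b m by blast
  have "0 =\<^sub>v Q (m - \<beta> *s b)"
    using split_off_vector_val_eq[OF integer_submodule_M_perp b(1) m(1) \<beta> b(2) \<Delta>] u(2) m(2) by simp
  then show thesis
    using that[of "m - \<beta> *s b"] split_off_vector(1,2)[OF integer_submodule_M_perp b(1) m(1) \<beta>]
    by simp
qed

lemma maximality_frame_if_codim_1:
  assumes Z: "unit_frame Z" "Z \<subseteq> M" "card Z + 1 = dim V"
    and m: "m \<in> M \<inter> perp Z" "\<not> 2 \<le>\<^sub>v Q m"
  shows "maximality_frame Z {m}"
proof -
  have "Q m \<noteq> 0" using m(2) by auto
  then have mZ: "orthogonal_frame (insert m Z)" "m \<notin> Z"
    using orthogonal_frame_insert[OF unit_frameD(1)[OF Z(1)]] m by blast+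
  then have card: "card (insert m Z) = dim V" using Z(3) unit_frameD(2)[OF Z(1)] by simp
  have mZV: "insert m Z \<subseteq> V" using Z(2) m(1) M_subset_V by blast
  have "0 \<le>\<^sub>v B x m / Q m" if x: "x \<in> V \<inter> perp Z" "0 \<le>\<^sub>v Q x" for x
  proof -
    define c where "c = B x m / Q m"
    have "x - c *s m \<in> V \<inter> perp Z"
      using x(1) m(1) mZV by (intro subspace_diff subspace_scale subspace_V_perp) auto
    then have "x - c *s m \<in> V \<inter> perp (insert m Z)" using \<open>Q m \<noteq> 0\<close> by (simp add: B_simps c_def)
    then have "x = c *s m" using eq_zero_if_perp_full_frame[OF mZ(1) mZV card] by fastforce
    then have "Q x = Q (c *s m)" by simp
    then have "0 \<le>\<^sub>v c * c * Q m" using x(2) by (simp add: B_simps mult.assoc)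
    then show ?thesis unfolding c_def [symmetric] using m(2) by (rule val_ge_0_if_square_mult)
  qed
  then show ?thesis using Z mZ m card by (simp add: maximality_frame_def)
qed

lemma maximality_frame_if_anisotropic_pair:
  assumes Z: "unit_frame Z" "Z \<subseteq> M" "card Z = n + 1"
    and bw: "b \<in> Z" "w \<in> Z" "b \<noteq> w" and aniso: "\<not> residue_square (- (Q b * Q w))"
  shows "\<exists>Y. maximality_frame Z Y"
proof (cases "dim V = n + 1")
  case True
  then have "maximality_frame Z {}" using Z unit_frameD(1) by (simp add: maximality_frame_def)
  then show ?thesis by blast
next
  case False
  then have dim: "dim V = n + 2" using dim_V by simp
  note frame_Z = unit_frameD(1)[OF Z(1)]
  define X where "X = Z - {b, w}"
  have X: "unit_frame X" "X \<subseteq> M" "card X = n - 1"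
    using unit_frame_subset[OF Z(1), of X] Z bw unit_frameD(2)[OF Z(1)]
    by (auto simp: X_def card_Diff_subset)
  have Z_eq: "Z = insert w (insert b X)" using bw by (auto simp: X_def)
  have mem: "b \<in> M \<inter> perp X" "w \<in> M \<inter> perp X"
    using orthogonal_frameD(3)[OF frame_Z] bw Z(2) by (auto simp: X_def perp_def)
  have units: "0 =\<^sub>v Q b" "0 =\<^sub>v Q w" using unit_frameD(3)[OF Z(1)] bw by auto
  have orth: "B b w = 0" "B w b = 0" using orthogonal_frameD(3)[OF frame_Z] bw by auto
  obtain k where k: "k \<in> V \<inter> perp Z" "0 =\<^sub>v Q k \<or> 1 =\<^sub>v Q k"
    using val_0_1_vector_perp_exists[OF frame_Z] Z dim M_subset_V by (metis add_less_cancel_left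
        one_less_numeral_iff semiring_norm(76) subset_trans)
  obtain u where u: "u \<in> V \<inter> perp X" "1 =\<^sub>v Q u"
    using subspace_prime_norm_exists[OF subspace_V_perp _ _ _ orth(1) _ _ units k(2), of X]
      mem k(1) M_subset_V B_commute by (auto simp: Z_eq)
  then obtain m where m: "m \<in> M \<inter> perp X" "Q m = Q u"
    using perp_represents[OF X u(1)] val_eq_nonzero val_eq_imp_val_ge[OF u(2), of 0] by auto
  have "w \<in> M \<inter> perp (insert b X)" using mem(2) orth(2) by simp
  then obtain \<beta> \<gamma> m' where m': "0 \<le>\<^sub>v \<beta>" "0 \<le>\<^sub>v \<gamma>" "m' \<in> M \<inter> perp Z"
    "Q m = Q b * (\<beta> * \<beta>) + Q w * (\<gamma> * \<gamma>) + Q m'"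
    using split_off_unit_pair[OF integral_M mem(1) units(1) _ units(2) m(1)] unfolding Z_eq by metis
  then have "\<not> 2 \<le>\<^sub>v Q m'"
    using anisotropic_prime_remainder[OF units aniso m'(1,2)] u(2) m(2) by simp
  then have "maximality_frame Z {m'}"
    using Z dim m'(3) by (intro maximality_frame_if_codim_1) auto
  then show ?thesis by blast
qed

theorem maximality_frame_exists: "\<exists>X Y. maximality_frame X Y"
proof -
  obtain X where X: "unit_frame X" "X \<subseteq> M" "card X = n - 1" by (rule unit_frame_in_M_exists)
  have small: "card X + 1 < dim V" using X(3) dim_V n_ge_2 by auto
  show ?thesis
  proof (cases "saturated X")
    case True
    then show ?thesis
      using saturated_imp_maximality_frame[OF True X(2) unit_frame_represents_perp_primes[OF X]] small
      by auto
  next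
    case False
    then obtain b where b: "b \<in> M \<inter> perp X" "0 =\<^sub>v Q b"
      by (rule unit_vector_perp_exists[OF X])
    have bX: "unit_frame (insert b X)" "b \<notin> X" using unit_frame_insert[OF X(1) _ b(2)] b by blast+
    have card_bX: "card (insert b X) = card X + 1" using bX unit_frameD(2)[OF X(1)] by simp
    show ?thesis
    proof (cases "saturated (insert b X)")
      case True
      then show ?thesis
        using saturated_imp_maximality_frame[OF True _ insert_represents_perp_primes[OF X b True]]
          X(2) b(1) small card_bX by auto
    next
      case False
      then obtain w where w: "w \<in> M \<inter> perp (insert b X)" "0 =\<^sub>v Q w"
        using second_unit_vector_exists[OF X b] by blast
      have "unit_frame (insert w (insert b X))" "w \<notin> insert b X"
        using unit_frame_insert[OF bX(1) _ w(2)] w(1) by blast+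
      moreover from this have card: "card (insert w (insert b X)) = n + 1"
        using card_bX X(3) n_ge_2 unit_frameD(2)[OF bX(1)] by simp
      moreover have "insert w (insert b X) \<subseteq> M" "3 \<le> card (insert w (insert b X))"
        using X(2) b(1) w(1) n_ge_2 card by auto
      ultimately obtain Z b' w' where "unit_frame Z" "Z \<subseteq> M" "card Z = n + 1"
        "b' \<in> Z" "w' \<in> Z" "b' \<noteq> w'" "\<not> residue_square (- (Q b' * Q w'))"
        using unit_frame_anisotropic_pair[OF integer_submodule_M] by metis
      then show ?thesis using maximality_frame_if_anisotropic_pair by blast
    qed
  qed
qed

end

context quadratic_ambient
begin

lemma integral_lattice_integer_span_frame:
  assumes Y: "orthogonal_frame Y" "\<forall>y\<in>Y. 0 \<le>\<^sub>v Q y"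
  shows "integral_lattice v (*s) B (integer_span v (*s) Y)"
proof -
  let ?N = "integer_span v (*s) Y"
  have finite: "finite Y" using Y(1) by (rule orthogonal_frameD)
  then have lattice: "lattice v (*s) ?N" by (auto simp: lattice_def)
  have "integral_submodule ?N"
  proof (rule integral_submodule_integer_span)
    show "0 \<le>\<^sub>v B x y" if "x \<in> Y" "y \<in> Y" for x y
      using orthogonal_frameD(3)[OF Y(1) that] Y(2) that by (cases "x = y") auto
  qed
  moreover have "quadratic_space (*s) B (span ?N)"
    unfolding quadratic_space_def span_integer_span
    by (intro conjI exI[of _ Y] ballI allI finite vector_space_axioms B_commute B_add_left
        B_scale_left refl)
  moreover have "nondegenerate B (span ?N)"
    unfolding nondegenerate_def span_integer_span
    using eq_zero_if_span_perp[OF Y(1)] span_base by (auto simp: perp_def)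
  ultimately show ?thesis
    using lattice integral_submodule_iff_lattice[OF lattice] by (simp add: integral_lattice_def)
qed

lemma n_ADC_imp_represents_frames:
  assumes ADC: "n_ADC v n (*s) B M"
  shows "represents_frames n (span M) M"
  unfolding represents_frames_def
proof (intro allI impI)
  fix Y assume Y: "orthogonal_frame Y" "Y \<subseteq> span M" "card Y = n" "\<forall>y\<in>Y. 0 \<le>\<^sub>v Q y"
  define N where "N = integer_span v (*s) Y"
  have span_N: "span N = span Y" unfolding N_def by (rule span_integer_span)
  have "integral_lattice v (*s) B N"
    unfolding N_def using Y(1,4) by (rule integral_lattice_integer_span_frame)
  moreover have "lattice_rank (*s) N = n"
    using dim_eq_card_independent[OF orthogonal_frame_independent[OF Y(1)]] Y(3)
    by (simp add: lattice_rank_def span_N)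
  moreover have "space_represents (*s) B (span M) (*s) B (span N)"
    unfolding space_represents_def span_N
    using linear_id span_minimal[OF Y(2) subspace_span] by (intro exI[of _ "\<lambda>x. x"]) auto
  ultimately have "lattice_represents (*s) B M (*s) B N"
    by (rule n_ADC_represents[OF ADC])
  then obtain \<sigma> where \<sigma>: "Vector_Spaces.linear (*s) (*s) \<sigma>" "\<forall>x\<in>span Y. Q (\<sigma> x) = Q x" "\<sigma> ` N \<subseteq> M"
    unfolding span_N[symmetric] by (auto simp: lattice_represents_def)
  have "Y \<subseteq> N" unfolding N_def by (rule integer_span_superset)
  then have "\<sigma> ` Y \<subseteq> M" using \<sigma>(3) by blast
  moreover have "B (\<sigma> x) (\<sigma> y) = B x y" if "x \<in> Y" "y \<in> Y" for x y
    using linear_preserves_B[OF \<sigma>(1) subspace_span \<sigma>(2)] that span_base by blast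
  ultimately show "\<exists>\<phi>. \<phi> ` Y \<subseteq> M \<and> (\<forall>x\<in>Y. \<forall>y\<in>Y. B (\<phi> x) (\<phi> y) = B x y)" by blast
qed

theorem n_ADC_imp_maximal_lattice:
  assumes n: "2 \<le> n" and M: "integral_lattice v (*s) B M"
    and rank: "lattice_rank (*s) M = n + 1 \<or> lattice_rank (*s) M = n + 2"
    and ADC: "n_ADC v n (*s) B M"
  shows "maximal_lattice v (*s) B M"
proof -
  have integral: "integral_submodule M"
    using M integral_submodule_iff_lattice by (simp add: integral_lattice_def)
  interpret frame_ADC_lattice v "(*s)" B "span M" n M
  proof unfold_locales
    show "\<exists>S. finite S \<and> span M = span S" "nondegenerate B (span M)"
      using M by (auto simp: integral_lattice_def quadratic_space_def)
    show "dim (span M) = n + 1 \<or> dim (span M) = n + 2" using rank by (simp add: lattice_rank_def)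
    show "represents_frames n (span M) M" using ADC by (rule n_ADC_imp_represents_frames)
  qed (use n integral span_superset in auto)
  obtain X Y where XY: "maximality_frame X Y" using maximality_frame_exists by blast
  have "K = M" if K: "lattice v (*s) K" "span K = span M" "M \<subseteq> K"
    and norm: "norm_ideal v B K \<subseteq> ring_of_integers v" for K
  proof -
    have "integral_submodule K" using K(1) norm integral_submodule_iff_lattice by blast
    moreover have "K \<subseteq> span M" using K(2) span_superset by blast
    ultimately show ?thesis using maximality_frame_imp_overmodule_subset[OF XY] K(3) by blast
  qed
  then show ?thesis using M by (simp add: maximal_lattice_def integral_lattice_def)
qed

theorem n_ADC_iff_maximal_lattice:
  assumes "2 \<le> n" and M: "integral_lattice v (*s) B M"
    and "lattice_rank (*s) M = n + 1 \<or> lattice_rank (*s) M = n + 2"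
  shows "n_ADC v n (*s) B M \<longleftrightarrow> maximal_lattice v (*s) B M"
  using n_ADC_imp_maximal_lattice[OF assms] maximal_lattice_imp_n_ADC M
  by (auto simp: integral_lattice_def)

end

section \<open>Forms that are bilinear on a subspace only\<close>

lemma n_ADC_cong:
  assumes "\<And>x. x \<in> module.span scale M \<Longrightarrow> B x x = B' x x"
  shows "n_ADC v n scale B M \<longleftrightarrow> n_ADC v n scale B' M"
proof -
  have "space_represents scale B (module.span scale M) seq_scale C W \<longleftrightarrow>
      space_represents scale B' (module.span scale M) seq_scale C W" for C W
    unfolding space_represents_def using assms by (metis image_subset_iff)
  moreover have "lattice_represents scale B M seq_scale C N \<longleftrightarrow>
      lattice_represents scale B' M seq_scale C N" for C N
    unfolding lattice_represents_def using assms by (metis image_subset_iff)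
  ultimately show ?thesis unfolding n_ADC_def by simp
qed

lemma norm_ideal_cong:
  assumes "\<And>x. x \<in> K \<Longrightarrow> B x x = B' x x"
  shows "norm_ideal v B K = norm_ideal v B' K"
proof -
  have "{B x x |x. x \<in> K} = {B' x x |x. x \<in> K}" using assms by force
  then show ?thesis by (simp add: norm_ideal_def)
qed

lemma maximal_lattice_cong:
  assumes "vector_space scale" and eq: "\<And>x. x \<in> module.span scale M \<Longrightarrow> B x x = B' x x"
  shows "maximal_lattice v scale B M \<longleftrightarrow> maximal_lattice v scale B' M"
proof -
  interpret vector_space scale by fact
  have "norm_ideal v B K = norm_ideal v B' K" if "span K = span M" for K
    using that eq span_base by (intro norm_ideal_cong) auto
  then show ?thesis unfolding maximal_lattice_def by (simp cong: conj_cong)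
qed

lemma integral_lattice_cong:
  assumes "vector_space scale"
    and eq: "\<And>x y. x \<in> module.span scale M \<Longrightarrow> y \<in> module.span scale M \<Longrightarrow> B x y = B' x y"
  shows "integral_lattice v scale B M \<longleftrightarrow> integral_lattice v scale B' M"
proof -
  interpret vector_space scale by fact
  have "quadratic_space scale B (span M) \<longleftrightarrow> quadratic_space scale B' (span M)"
    unfolding quadratic_space_def by (auto simp: eq span_add span_scale)
  moreover have "nondegenerate B (span M) \<longleftrightarrow> nondegenerate B' (span M)"
    by (auto simp: nondegenerate_def eq)
  moreover have "norm_ideal v B M = norm_ideal v B' M"
    using eq span_base by (intro norm_ideal_cong) auto
  ultimately show ?thesis by (simp add: integral_lattice_def)
qed

lemma quadratic_space_extend_form:
  assumes V: "quadratic_space scale B V"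
  obtains B' where "\<And>x y. x \<in> V \<Longrightarrow> y \<in> V \<Longrightarrow> B' x y = B x y" "\<And>x y. B' x y = B' y x"
    "\<And>x y z. B' (x + y) z = B' x z + B' y z" "\<And>c x y. B' (scale c x) y = c * B' x y"
proof -
  interpret vector_space scale using V by (simp add: quadratic_space_def)
  interpret pair: vector_space_pair scale scale ..
  have "Vector_Spaces.linear scale scale (\<lambda>x. x)"
    using vector_space_axioms by (simp add: Vector_Spaces.linear_iff)
  moreover have "subspace V" using V by (auto simp: quadratic_space_def)
  ultimately obtain p where p: "range p \<subseteq> V" "Vector_Spaces.linear scale scale p" "\<forall>x\<in>V. p x = x"
    using pair.linear_exists_left_inverse_on[of "\<lambda>x. x" V] by auto
  interpret p: Vector_Spaces.linear scale scale p by fact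
  have "p x \<in> V" for x using p(1) by blast
  then show thesis
    using that[of "\<lambda>x y. B (p x) (p y)"] V p(3)
    unfolding quadratic_space_def by (simp add: p.add p.scale)
qed

theorem theorem2p11:
  fixes v :: "'f::field \<Rightarrow> int"
    and n :: nat
    and scale :: "'f \<Rightarrow> 'v::ab_group_add \<Rightarrow> 'v"
    and B :: "'v \<Rightarrow> 'v \<Rightarrow> 'f"
    and M :: "'v set"
  assumes "nonarch_local_field v"
    and "non_dyadic v"
    and "n \<ge> 2"
    and "integral_lattice v scale B M"
    and "lattice_rank scale M = n + 1 \<or> lattice_rank scale M = n + 2"
  shows "n_ADC v n scale B M \<longleftrightarrow> maximal_lattice v scale B M"
proof -
  have qs: "quadratic_space scale B (module.span scale M)"
    using assms(4) by (simp add: integral_lattice_def)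
  then have vs: "vector_space scale" by (simp add: quadratic_space_def)
  obtain B' where eq: "\<And>x y. x \<in> module.span scale M \<Longrightarrow> y \<in> module.span scale M \<Longrightarrow> B' x y = B x y"
    and B': "\<And>x y. B' x y = B' y x" "\<And>x y z. B' (x + y) z = B' x z + B' y z"
      "\<And>c x y. B' (scale c x) y = c * B' x y"
    using quadratic_space_extend_form[OF qs] by blast
  interpret quadratic_ambient v scale B'
    by (intro quadratic_ambient.intro nondyadic_local_field.intro nondyadic_local_field_axioms.intro
        valued_vector_space.intro quadratic_ambient_axioms.intro assms(1,2) vs B')
  have "integral_lattice v scale B' M" using assms(4) integral_lattice_cong[OF vs, of M B' B] eq by simp
  then have "n_ADC v n scale B' M \<longleftrightarrow> maximal_lattice v scale B' M"
    using assms(3,5) by (intro n_ADC_iff_maximal_lattice)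
  then show ?thesis
    using n_ADC_cong[of scale M B' B] maximal_lattice_cong[OF vs, of M B' B] eq by blast
qed

end
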